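(* Let $\mathscr M$ be a von Neumann algebra without direct summand of type $\mathrm{I}_1$, and let $\Phi\colon\mathscr M\to\mathscr M$ be an ortho-additive range-contractive map (not assumed linear, continuous, injective or surjective). Then $\Phi(A)=A\Phi(I)$ for every $A\in\mathscr M$.
   Context: A von Neumann algebra is a self-adjoint unital subalgebra of $\mathscr{B}(\mathscr H)$, closed in the weak-operator topology, where $\mathscr H$ is a complex Hilbert space (not necessarily separable); $I$ is its identity. "$\mathscr M$ has no direct summand of type $\mathrm{I}_1$" means there is no nonzero central projection $Z\in\mathscr M$ such that $\mathscr MZ$ is abelian. For $A\in\mathscr M$, $\mathcal R(A)\in\mathscr M$ denotes the range projection of $A$ (the projection onto the closure of the range of $A$). Operators $A,B\in\mathscr M$ are orthogonal, written $A\perp B$, if $A^*B=0$ (equivalently, $\mathcal R(A)\mathcal R(B)=0$). A map $\Phi\colon\mathscr M\to\mathscr M$ is ortho-additive if $\Phi(A+B)=\Phi(A)+\Phi(B)$ for all $A,B\in\mathscr M$ with $A\perp B$; it is range-contractive if $\mathcal R(\Phi(A))\leqslant\mathcal R(A)$ for all $A\in\mathscr M$. *)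

theory Defs
  imports "HOL-Analysis.Analysis"
begin

text \<open>A complex Hilbert space is a complete normed space whose real scalar multiplication extends
  to a complex one and whose norm comes from a complex inner product. The inner product is
  conjugate-linear in the first argument and linear in the second.\<close>

class complex_hilbert_space = banach +
  fixes scaleC :: "complex \<Rightarrow> 'a \<Rightarrow> 'a" (infixr \<open>*\<^sub>C\<close> 75)
    and cinner :: "'a \<Rightarrow> 'a \<Rightarrow> complex"
  assumes scaleR_scaleC: "r *\<^sub>R x = complex_of_real r *\<^sub>C x"
    and scaleC_add_right: "c *\<^sub>C (x + y) = c *\<^sub>C x + c *\<^sub>C y"
    and scaleC_add_left: "(c + d) *\<^sub>C x = c *\<^sub>C x + d *\<^sub>C x"
    and scaleC_scaleC: "c *\<^sub>C (d *\<^sub>C x) = (c * d) *\<^sub>C x"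
    and scaleC_one: "1 *\<^sub>C x = x"
    and cinner_commute: "cinner x y = cnj (cinner y x)"
    and cinner_add_right: "cinner x (y + z) = cinner x y + cinner x z"
    and cinner_scaleC_right: "cinner x (c *\<^sub>C y) = c * cinner x y"
    and cinner_ge_zero: "0 \<le> Re (cinner x x)"
    and cinner_eq_zero_iff: "cinner x x = 0 \<longleftrightarrow> x = 0"
    and norm_eq_sqrt_cinner: "norm x = sqrt (Re (cinner x x))"

lemma norm_scaleC: "norm (c *\<^sub>C x) = cmod c * norm (x :: 'h::complex_hilbert_space)"
proof -
  have left: "cinner (c *\<^sub>C x) y = cnj c * cinner x y" for y
    by (metis cinner_commute cinner_scaleC_right complex_cnj_cnj complex_cnj_mult)
  have "cinner (c *\<^sub>C x) (c *\<^sub>C x) = complex_of_real ((cmod c)\<^sup>2) * cinner x x"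
    using complex_norm_square[of c] by (simp add: left cinner_scaleC_right mult.assoc)
  hence "Re (cinner (c *\<^sub>C x) (c *\<^sub>C x)) = (cmod c)\<^sup>2 * Re (cinner x x)"
    by (simp only: Re_complex_of_real Im_complex_of_real times_complex.simps)
  thus ?thesis
    by (simp add: norm_eq_sqrt_cinner real_sqrt_mult)
qed

text \<open>Elements of \<open>'h \<Rightarrow>\<^sub>L 'h\<close> are only real-linear; the bounded operators of the complex
  Hilbert space are those that also respect complex scalars.\<close>

definition bounded_ops :: "('h::complex_hilbert_space \<Rightarrow>\<^sub>L 'h) set" where
  "bounded_ops = {A. \<forall>c x. blinfun_apply A (c *\<^sub>C x) = c *\<^sub>C blinfun_apply A x}"

lift_definition op_scaleC ::
  "complex \<Rightarrow> ('h::complex_hilbert_space \<Rightarrow>\<^sub>L 'h) \<Rightarrow> ('h \<Rightarrow>\<^sub>L 'h)"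
  is "\<lambda>c A x. c *\<^sub>C A x"
proof -
  fix c and A :: "'h \<Rightarrow> 'h"
  assume "bounded_linear A"
  then interpret A: bounded_linear A .
  obtain K where K: "norm (A x) \<le> norm x * K" for x
    using A.bounded by blast
  show "bounded_linear (\<lambda>x. c *\<^sub>C A x)"
  proof (rule bounded_linear_intro)
    show "c *\<^sub>C A (x + y) = c *\<^sub>C A x + c *\<^sub>C A y" for x y
      by (simp add: A.add scaleC_add_right)
    show "c *\<^sub>C A (r *\<^sub>R x) = r *\<^sub>R (c *\<^sub>C A x)" for r x
      by (simp add: A.scaleR) (simp add: scaleR_scaleC scaleC_scaleC mult.commute)
    show "norm (c *\<^sub>C A x) \<le> norm x * (cmod c * K)" for x
      using mult_left_mono[OF K[of x], of "cmod c"] by (simp add: norm_scaleC mult_ac)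
  qed
qed

definition adj :: "('h::complex_hilbert_space \<Rightarrow>\<^sub>L 'h) \<Rightarrow> ('h \<Rightarrow>\<^sub>L 'h)" where
  "adj A = (THE B. B \<in> bounded_ops \<and>
     (\<forall>x y. cinner (blinfun_apply B x) y = cinner x (blinfun_apply A y)))"

text \<open>The coarsest topology on the bounded operators for which all the maps
  \<open>A \<mapsto> \<langle>x, A y\<rangle>\<close> are continuous; \<open>euclidean\<close> is here the
  product topology on \<open>'h \<times> 'h \<Rightarrow> complex\<close>.\<close>

definition weak_operator_topology :: "('h::complex_hilbert_space \<Rightarrow>\<^sub>L 'h) topology" where
  "weak_operator_topology =
     pullback_topology bounded_ops (\<lambda>A (x, y). cinner x (blinfun_apply A y)) euclidean"

definition von_neumann_algebra :: "('h::complex_hilbert_space \<Rightarrow>\<^sub>L 'h) set \<Rightarrow> bool" where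
  "von_neumann_algebra M \<longleftrightarrow>
     M \<subseteq> bounded_ops \<and>
     id_blinfun \<in> M \<and>
     (\<forall>A\<in>M. \<forall>B\<in>M. A + B \<in> M) \<and>
     (\<forall>c. \<forall>A\<in>M. op_scaleC c A \<in> M) \<and>
     (\<forall>A\<in>M. \<forall>B\<in>M. A o\<^sub>L B \<in> M) \<and>
     (\<forall>A\<in>M. adj A \<in> M) \<and>
     closedin weak_operator_topology M"

definition projection :: "('h::complex_hilbert_space \<Rightarrow>\<^sub>L 'h) \<Rightarrow> bool" where
  "projection P \<longleftrightarrow> P \<in> bounded_ops \<and> P o\<^sub>L P = P \<and> adj P = P"

definition central :: "('h::complex_hilbert_space \<Rightarrow>\<^sub>L 'h) set \<Rightarrow> ('h \<Rightarrow>\<^sub>L 'h) \<Rightarrow> bool" where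
  "central M Z \<longleftrightarrow> Z \<in> M \<and> (\<forall>A\<in>M. A o\<^sub>L Z = Z o\<^sub>L A)"

definition abelian :: "('h::complex_hilbert_space \<Rightarrow>\<^sub>L 'h) set \<Rightarrow> bool" where
  "abelian N \<longleftrightarrow> (\<forall>A\<in>N. \<forall>B\<in>N. A o\<^sub>L B = B o\<^sub>L A)"

definition no_type_I1_summand :: "('h::complex_hilbert_space \<Rightarrow>\<^sub>L 'h) set \<Rightarrow> bool" where
  "no_type_I1_summand M \<longleftrightarrow>
     \<not> (\<exists>Z. Z \<noteq> 0 \<and> projection Z \<and> central M Z \<and> abelian ((\<lambda>A. A o\<^sub>L Z) ` M))"

definition range_projection :: "('h::complex_hilbert_space \<Rightarrow>\<^sub>L 'h) \<Rightarrow> ('h \<Rightarrow>\<^sub>L 'h)" where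
  "range_projection A =
     (THE P. projection P \<and> range (blinfun_apply P) = closure (range (blinfun_apply A)))"

text \<open>The usual order on operators: \<open>B - A\<close> is positive. The set of nonnegative reals is here
  a subset of the complex numbers.\<close>

definition op_le :: "('h::complex_hilbert_space \<Rightarrow>\<^sub>L 'h) \<Rightarrow> ('h \<Rightarrow>\<^sub>L 'h) \<Rightarrow> bool" where
  "op_le A B \<longleftrightarrow> (\<forall>x. cinner x (blinfun_apply (B - A) x) \<in> \<real>\<^sub>\<ge>\<^sub>0)"

definition orthogonal_ops :: "('h::complex_hilbert_space \<Rightarrow>\<^sub>L 'h) \<Rightarrow> ('h \<Rightarrow>\<^sub>L 'h) \<Rightarrow> bool" where
  "orthogonal_ops A B \<longleftrightarrow> adj A o\<^sub>L B = 0"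

definition ortho_additive ::
  "('h::complex_hilbert_space \<Rightarrow>\<^sub>L 'h) set \<Rightarrow> (('h \<Rightarrow>\<^sub>L 'h) \<Rightarrow> ('h \<Rightarrow>\<^sub>L 'h)) \<Rightarrow> bool" where
  "ortho_additive M \<Phi> \<longleftrightarrow>
     (\<forall>A\<in>M. \<forall>B\<in>M. orthogonal_ops A B \<longrightarrow> \<Phi> (A + B) = \<Phi> A + \<Phi> B)"

definition range_contractive ::
  "('h::complex_hilbert_space \<Rightarrow>\<^sub>L 'h) set \<Rightarrow> (('h \<Rightarrow>\<^sub>L 'h) \<Rightarrow> ('h \<Rightarrow>\<^sub>L 'h)) \<Rightarrow> bool" where
  "range_contractive M \<Phi> \<longleftrightarrow>
     (\<forall>A\<in>M. op_le (range_projection (\<Phi> A)) (range_projection A))"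

end

theory Submission
  imports Defs
begin

text \<open>Put \<open>\<Psi> A = \<Phi> A - A \<Phi> I\<close>; it is again ortho-additive and range-contractive, and \<open>\<Psi> I = 0\<close>.
  Splitting \<open>A = PA + (I - P)A\<close> gives \<open>\<Psi> (PA) = P \<Psi> A\<close> for every projection \<open>P\<close>. Applied to graph
  projections, this yields \<open>\<Psi> (X + KY) = \<Psi> X + K \<Psi> Y\<close> whenever \<open>X = EX\<close>, \<open>K = EK(I - E)\<close> and
  \<open>EY = 0\<close>, hence \<open>(I - E)LE \<Psi> A = 0\<close> for all \<open>L\<close> and \<open>A\<close>. So all projections of the algebra commute
  with all of it on the ranges of the \<open>\<Psi> A\<close>. The largest subspace where this happens reduces the
  algebra to an abelian one, and its projection is central; without a summand of type \<open>I\<^sub>1\<close> it is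
  zero.\<close>

section \<open>Complex inner products and orthogonal decomposition\<close>

text \<open>Two obstacles shape the proof. \<open>\<Psi>\<close> is known to respect sums only when
  the ranges are orthogonal, so additivity has to be carried over to summands with a common range
  before two computations of the value at one product \<open>L A\<close> can be compared. On the
  algebra side, new elements of \<open>M\<close> come only from algebraic operations and from
  closedness in the weak-operator topology. Each required projection is therefore exhibited as a
  strong limit: kernel projections through ergodic means, the projection onto a common kernel
  through a net of such projections. Likewise the passage from commuting projections to commuting
  operators, usually an appeal to the spectral theorem, is made with a square root obtained by
  iteration and with repeated polar decompositions.\<close>

lemma cinner_add_left: "cinner (x + y) (z :: 'h::complex_hilbert_space) = cinner x z + cinner y z"
  by (metis cinner_add_right cinner_commute complex_cnj_add)

lemma cinner_scaleC_left: "cinner (c *\<^sub>C x) (y :: 'h::complex_hilbert_space) = cnj c * cinner x y"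
  by (metis cinner_commute cinner_scaleC_right complex_cnj_cnj complex_cnj_mult)

lemma cinner_scaleR_right: "cinner x (r *\<^sub>R (y :: 'h::complex_hilbert_space)) = r * cinner x y"
  by (simp add: scaleR_scaleC cinner_scaleC_right)

lemma cinner_scaleR_left: "cinner (r *\<^sub>R x) (y :: 'h::complex_hilbert_space) = r * cinner x y"
  by (simp add: scaleR_scaleC cinner_scaleC_left)

lemma cinner_zero_right [simp]: "cinner x (0 :: 'h::complex_hilbert_space) = 0"
  using cinner_scaleR_right[of x 0 0] by simp

lemma cinner_zero_left [simp]: "cinner (0 :: 'h::complex_hilbert_space) x = 0"
  using cinner_scaleR_left[of 0 0 x] by simp

lemma cinner_minus_right: "cinner x (- y :: 'h::complex_hilbert_space) = - cinner x y"
  using cinner_scaleR_right[of x "-1" y] by simp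

lemma cinner_minus_left: "cinner (- x) (y :: 'h::complex_hilbert_space) = - cinner x y"
  using cinner_scaleR_left[of "-1" x y] by simp

lemma cinner_diff_right: "cinner x (y - z :: 'h::complex_hilbert_space) = cinner x y - cinner x z"
  using cinner_add_right[of x y "- z"] by (simp add: cinner_minus_right)

lemma cinner_diff_left: "cinner (x - y) (z :: 'h::complex_hilbert_space) = cinner x z - cinner y z"
  using cinner_add_left[of x "- y" z] by (simp add: cinner_minus_left)

lemmas cinner_simps = cinner_add_left cinner_add_right cinner_diff_left cinner_diff_right
  cinner_scaleR_left cinner_scaleR_right cinner_scaleC_left cinner_scaleC_right
  cinner_minus_left cinner_minus_right

lemma norm_squared_eq_cinner: "(norm (x :: 'h::complex_hilbert_space))\<^sup>2 = Re (cinner x x)"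
  by (simp add: norm_eq_sqrt_cinner cinner_ge_zero)

lemma cinner_self_eq_norm: "cinner x x = complex_of_real ((norm (x :: 'h::complex_hilbert_space))\<^sup>2)"
proof -
  have "Im (cinner x x) = 0"
    using cinner_commute[of x x] by (metis cnj.sel(2) equal_neg_zero)
  thus ?thesis by (simp add: norm_squared_eq_cinner complex_eq_iff)
qed

lemma cinner_eq_right_imp_eq:
  assumes "\<And>z. cinner z x = cinner z (y :: 'h::complex_hilbert_space)"
  shows "x = y"
  using assms[of "x - y"] cinner_eq_zero_iff[of "x - y"] by (simp add: cinner_diff_right)

lemma cinner_eq_left_imp_eq:
  assumes "\<And>z. cinner x z = cinner (y :: 'h::complex_hilbert_space) z"
  shows "x = y"
  by (metis assms cinner_commute cinner_eq_right_imp_eq)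

lemma norm_add_squared:
  "(norm (x + y :: 'h::complex_hilbert_space))\<^sup>2 = (norm x)\<^sup>2 + 2 * Re (cinner x y) + (norm y)\<^sup>2"
  using cinner_commute[of y x] by (simp add: norm_squared_eq_cinner cinner_simps)

lemma norm_diff_squared:
  "(norm (x - y :: 'h::complex_hilbert_space))\<^sup>2 = (norm x)\<^sup>2 - 2 * Re (cinner x y) + (norm y)\<^sup>2"
  using cinner_commute[of y x] by (simp add: norm_squared_eq_cinner cinner_simps)

text \<open>Expand the square of the norm of \<open>n x - c y\<close>, a multiple of the component
  of \<open>x\<close> orthogonal to \<open>y\<close>; multiplying through by \<open>n\<close>, the
  square of \<open>norm y\<close>, postpones the division to the end.\<close>

lemma cauchy_schwarz: "cmod (cinner x y) \<le> norm x * norm (y :: 'h::complex_hilbert_space)"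
proof (cases "y = 0")
  case False
  define n where "n = (norm y)\<^sup>2"
  define c where "c = cinner y x"
  have n: "n > 0" using False by (simp add: n_def)
  have "cinner (n *\<^sub>R x) (c *\<^sub>C y) = n * (c * cnj c)"
    using cinner_commute[of x y] by (simp add: cinner_simps c_def)
  hence re: "Re (cinner (n *\<^sub>R x) (c *\<^sub>C y)) = n * (cmod c)\<^sup>2"
    by (simp flip: complex_norm_square)
  have "0 \<le> (norm (n *\<^sub>R x - c *\<^sub>C y))\<^sup>2" by simp
  also have "\<dots> = n\<^sup>2 * (norm x)\<^sup>2 - 2 * (n * (cmod c)\<^sup>2) + (cmod c)\<^sup>2 * n"
    unfolding norm_diff_squared re by (simp add: norm_scaleC power_mult_distrib n_def)
  finally have "n * (cmod c)\<^sup>2 \<le> n * (n * (norm x)\<^sup>2)"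
    by (simp add: power2_eq_square algebra_simps)
  hence "(cmod c)\<^sup>2 \<le> (norm x * norm y)\<^sup>2"
    using n by (simp add: n_def power_mult_distrib mult.commute)
  hence "cmod c \<le> norm x * norm y" by (rule power2_le_imp_le) simp
  moreover have "cmod c = cmod (cinner x y)"
    using cinner_commute[of x y] by (simp add: c_def)
  ultimately show ?thesis by simp
qed simp

lemma bounded_bilinear_cinner:
  "bounded_bilinear (cinner :: 'h::complex_hilbert_space \<Rightarrow> 'h \<Rightarrow> complex)"
proof
  show "\<exists>K. \<forall>a b::'h. norm (cinner a b) \<le> norm a * norm b * K"
    using cauchy_schwarz by (intro exI[of _ 1]) auto
qed (auto simp: cinner_simps scaleR_conv_of_real)

lemmas tendsto_cinner = bounded_bilinear.tendsto[OF bounded_bilinear_cinner]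
lemmas continuous_on_cinner = bounded_bilinear.continuous_on[OF bounded_bilinear_cinner]

section \<open>Nearest points in closed subspaces\<close>

definition complex_subspace :: "'h::complex_hilbert_space set \<Rightarrow> bool" where
  "complex_subspace S \<longleftrightarrow> 0 \<in> S \<and> (\<forall>x\<in>S. \<forall>y\<in>S. x + y \<in> S) \<and> (\<forall>c. \<forall>x\<in>S. c *\<^sub>C x \<in> S)"

lemma scaleC_zero_right [simp]: "c *\<^sub>C (0 :: 'h::complex_hilbert_space) = 0"
  using norm_scaleC[of c "0::'h"] by simp

lemma complex_subspace_diff:
  assumes "complex_subspace S" "x \<in> S" "y \<in> S"
  shows "x - y \<in> S"
proof -
  have "x + (complex_of_real (-1)) *\<^sub>C y \<in> S" using assms by (auto simp: complex_subspace_def)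
  thus ?thesis by (simp add: scaleR_scaleC[symmetric] del: of_real_minus)
qed

text \<open>Otherwise a small step along \<open>s\<close> would shorten \<open>z\<close>. The 1 in
  the denominator of \<open>t\<close> makes the step defined for \<open>s = 0\<close> and short
  enough for the first-order gain to beat the quadratic loss.\<close>

lemma orthogonal_if_minimal:
  fixes z s :: "'h::complex_hilbert_space"
  assumes "\<And>c. norm z \<le> norm (z - c *\<^sub>C s)"
  shows "cinner s z = 0"
proof -
  define t where "t = 1 / (1 + (norm s)\<^sup>2)"
  define c where "c = cinner s z"
  have pos: "1 + (norm s)\<^sup>2 > 0" by (simp add: add_pos_nonneg)
  have t: "t > 0" "t * (norm s)\<^sup>2 < 1" using pos by (auto simp: t_def divide_simps)
  have "cinner z ((t * c) *\<^sub>C s) = t * (c * cnj c)"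
    using cinner_commute[of z s] by (simp add: cinner_simps c_def)
  hence re: "Re (cinner z ((t * c) *\<^sub>C s)) = t * (cmod c)\<^sup>2"
    by (simp flip: complex_norm_square)
  have "(norm z)\<^sup>2 \<le> (norm (z - (t * c) *\<^sub>C s))\<^sup>2" using assms by (simp add: power_mono)
  also have "\<dots> = (norm z)\<^sup>2 - 2 * (t * (cmod c)\<^sup>2) + t\<^sup>2 * (cmod c)\<^sup>2 * (norm s)\<^sup>2"
    unfolding norm_diff_squared re by (simp add: norm_scaleC norm_mult power_mult_distrib)
  finally have "0 \<le> t * (cmod c)\<^sup>2 * (t * (norm s)\<^sup>2 - 2)"
    by (simp add: power2_eq_square algebra_simps)
  hence "t * (cmod c)\<^sup>2 \<le> 0" using t by (simp add: zero_le_mult_iff)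
  hence "(cmod c)\<^sup>2 \<le> 0" using t by (simp add: mult_le_0_iff)
  thus ?thesis by (simp add: c_def)
qed

text \<open>A minimizing sequence is Cauchy by the parallelogram law, and its limit is a nearest
  point. The excess over the distance \<open>d\<close> is measured in squares, since that law is
  linear in them.\<close>

lemma orthogonal_decomposition:
  fixes S :: "'h::complex_hilbert_space set"
  assumes S: "complex_subspace S" "closed S"
  shows "\<exists>p\<in>S. \<forall>s\<in>S. cinner s (x - p) = 0"
proof -
  define d where "d = infdist x S"
  have ne: "S \<noteq> {}" using S by (auto simp: complex_subspace_def)
  have dle: "d \<le> norm (x - s)" if "s \<in> S" for s
    using infdist_le[OF that, of x] by (simp add: d_def dist_norm)
  have d0: "d \<ge> 0" by (simp add: d_def infdist_nonneg)
  have "\<exists>s\<in>S. (norm (x - s))\<^sup>2 < d\<^sup>2 + inverse (Suc n)" for n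
  proof -
    have "d < sqrt (d\<^sup>2 + inverse (Suc n))"
      using d0 by (intro real_less_rsqrt) auto
    hence "\<exists>s\<in>S. dist x s < sqrt (d\<^sup>2 + inverse (Suc n))"
      unfolding d_def using ne
      by (metis infdist_notempty cINF_less_iff bdd_below_image_dist)
    then obtain s where s: "s \<in> S" "norm (x - s) < sqrt (d\<^sup>2 + inverse (Suc n))"
      by (auto simp: dist_norm)
    hence "(norm (x - s))\<^sup>2 < (sqrt (d\<^sup>2 + inverse (Suc n)))\<^sup>2"
      by (intro power_strict_mono) auto
    with s show ?thesis by auto
  qed
  then obtain f where f: "\<And>n. f n \<in> S"
    and fd: "\<And>n. (norm (x - f n))\<^sup>2 < d\<^sup>2 + inverse (Suc n)" by metis
  have step: "(norm (f m - f n))\<^sup>2 \<le> 2 * inverse (Suc m) + 2 * inverse (Suc n)" for m n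
  proof -
    define u v where "u = x - f m" and "v = x - f n"
    \<comment> \<open>The midpoint of two elements of \<open>S\<close> is at distance at least
      \<open>d\<close> from \<open>x\<close>, which bounds \<open>norm (u + v)\<close> below and
      hence \<open>norm (u - v)\<close> above.\<close>
    have mid: "(1/2) *\<^sub>R (f m + f n) \<in> S"
      using f S unfolding scaleR_scaleC complex_subspace_def by blast
    have "u + v = 2 *\<^sub>R (x - (1/2) *\<^sub>R (f m + f n))"
      by (simp add: u_def v_def algebra_simps scaleR_2)
    hence "norm (u + v) = 2 * norm (x - (1/2) *\<^sub>R (f m + f n))" by simp
    hence "2 * d \<le> norm (u + v)" using dle[OF mid] by simp
    hence "(2 * d)\<^sup>2 \<le> (norm (u + v))\<^sup>2" using d0 by (intro power_mono) auto
    moreover have "(norm (u - v))\<^sup>2 = 2 * (norm u)\<^sup>2 + 2 * (norm v)\<^sup>2 - (norm (u + v))\<^sup>2"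
      by (simp add: norm_add_squared norm_diff_squared)
    moreover have "norm (u - v) = norm (f m - f n)" by (simp add: u_def v_def norm_minus_commute)
    ultimately show ?thesis using fd[of m] fd[of n]
      by (simp add: u_def v_def power_mult_distrib)
  qed
  have "Cauchy f"
  proof (rule metric_CauchyI)
    fix e :: real assume e: "e > 0"
    obtain N where N: "inverse (real (Suc N)) < e\<^sup>2 / 4"
      using reals_Archimedean[of "e\<^sup>2 / 4"] e by auto
    have "dist (f m) (f n) < e" if "m \<ge> N" "n \<ge> N" for m n
    proof -
      have "inverse (real (Suc m)) \<le> inverse (Suc N)" "inverse (real (Suc n)) \<le> inverse (Suc N)"
        using that by (auto intro!: le_imp_inverse_le)
      hence "(norm (f m - f n))\<^sup>2 < e\<^sup>2" using step[of m n] N by linarith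
      thus ?thesis using e by (simp add: dist_norm power_less_imp_less_base)
    qed
    thus "\<exists>M. \<forall>m\<ge>M. \<forall>n\<ge>M. dist (f m) (f n) < e" by blast
  qed
  then obtain p where p: "f \<longlonglongrightarrow> p" using Cauchy_convergent_iff convergent_def by blast
  have pS: "p \<in> S" using closed_sequentially[OF S(2)] f p by blast
  have "(norm (x - p))\<^sup>2 \<le> d\<^sup>2 + 0"
  proof (rule LIMSEQ_le)
    show "(\<lambda>n. (norm (x - f n))\<^sup>2) \<longlonglongrightarrow> (norm (x - p))\<^sup>2" by (intro tendsto_intros p)
    show "(\<lambda>n. d\<^sup>2 + inverse (Suc n)) \<longlonglongrightarrow> d\<^sup>2 + 0"
      by (intro tendsto_intros LIMSEQ_inverse_real_of_nat)
    show "\<exists>N. \<forall>n\<ge>N. (norm (x - f n))\<^sup>2 \<le> d\<^sup>2 + inverse (real (Suc n))"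
      using fd less_imp_le by blast
  qed
  hence pd: "norm (x - p) \<le> d" using d0 by (simp add: power2_le_iff_abs_le)
  have "cinner s (x - p) = 0" if "s \<in> S" for s
  proof (rule orthogonal_if_minimal)
    fix c
    have "p + c *\<^sub>C s \<in> S" using S pS that by (auto simp: complex_subspace_def)
    thus "norm (x - p) \<le> norm (x - p - c *\<^sub>C s)"
      using dle[of "p + c *\<^sub>C s"] pd by (simp add: diff_diff_eq)
  qed
  with pS show ?thesis by blast
qed

section \<open>Adjoints and projections\<close>

text \<open>The kernel of a nonzero functional has codimension one, so a vector orthogonal to it
  represents the functional up to a scalar; the conjugate on that scalar compensates for
  conjugate-linearity in the first argument.\<close>

lemma riesz_representation:
  fixes f :: "'h::complex_hilbert_space \<Rightarrow> complex"
  assumes f: "bounded_linear f" and fc: "\<And>c x. f (c *\<^sub>C x) = c * f x"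
  shows "\<exists>z. \<forall>x. f x = cinner z x"
proof (cases "\<forall>x. f x = 0")
  case True
  thus ?thesis by (intro exI[of _ 0]) simp
next
  case False
  then obtain u where u: "f u \<noteq> 0" by blast
  interpret f: bounded_linear f by (rule f)
  define S where "S = {x. f x = 0}"
  have S: "complex_subspace S" by (auto simp: S_def complex_subspace_def f.add fc)
  have "closed S" unfolding S_def
    by (intro closed_Collect_eq continuous_intros f.continuous_on)
  then obtain p where p: "p \<in> S" "\<And>s. s \<in> S \<Longrightarrow> cinner s (u - p) = 0"
    using orthogonal_decomposition[OF S, of u] by blast
  define v where "v = u - p"
  have fv: "f v \<noteq> 0" using u p by (simp add: v_def S_def f.diff)
  hence v0: "cinner v v \<noteq> 0" by (auto simp: cinner_eq_zero_iff f.zero)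
  have "f x = cinner (cnj (f v / cinner v v) *\<^sub>C v) x" for x
  proof -
    have "x - (f x / f v) *\<^sub>C v \<in> S" using fv by (simp add: S_def f.diff fc)
    hence "cinner (x - (f x / f v) *\<^sub>C v) v = 0" using p v_def by blast
    hence "cinner v (x - (f x / f v) *\<^sub>C v) = 0" by (metis cinner_commute complex_cnj_zero)
    hence "cinner v x = (f x / f v) * cinner v v" by (simp add: cinner_simps)
    thus ?thesis using fv v0 by (simp add: cinner_simps)
  qed
  thus ?thesis by blast
qed

lemma bounded_ops_scaleC: "A \<in> bounded_ops \<Longrightarrow> A (c *\<^sub>C x) = c *\<^sub>C A x"
  by (simp add: bounded_ops_def)

lemma bounded_linear_scaleC: "bounded_linear (\<lambda>x::'h::complex_hilbert_space. c *\<^sub>C x)"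
  using blinfun.bounded_linear_right[of "op_scaleC c (id_blinfun :: 'h \<Rightarrow>\<^sub>L 'h)"]
  by (simp add: op_scaleC.rep_eq)

lemma id_in_bounded_ops: "id_blinfun \<in> bounded_ops"
  by (simp add: bounded_ops_def)

lemma diff_in_bounded_ops: "A \<in> bounded_ops \<Longrightarrow> B \<in> bounded_ops \<Longrightarrow> A - B \<in> bounded_ops"
proof -
  assume "A \<in> bounded_ops" "B \<in> bounded_ops"
  moreover have "c *\<^sub>C (x - y) = c *\<^sub>C x - c *\<^sub>C y" for c and x y :: 'a
    using scaleC_add_right[of c "x - y" y] by (simp add: algebra_simps)
  ultimately show ?thesis by (simp add: bounded_ops_def blinfun.diff_left)
qed

lemma compose_in_bounded_ops:
  "A \<in> bounded_ops \<Longrightarrow> B \<in> bounded_ops \<Longrightarrow> A o\<^sub>L B \<in> bounded_ops"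
  by (simp add: bounded_ops_def)

text \<open>The inner product separates vectors, so the definite description in \<open>adj\<close>
  has at most one solution; adjoints are computed by exhibiting a candidate.\<close>

lemma adj_eqI:
  fixes A B :: "'h::complex_hilbert_space \<Rightarrow>\<^sub>L 'h"
  assumes "B \<in> bounded_ops" "\<And>x y. cinner (B x) y = cinner x (A y)"
  shows "adj A = B"
  unfolding adj_def
proof (rule the_equality)
  fix C assume C: "C \<in> bounded_ops \<and> (\<forall>x y. cinner (C x) y = cinner x (A y))"
  show "C = B"
    by (rule blinfun_eqI, rule cinner_eq_left_imp_eq) (use assms C in simp)
qed (use assms in auto)

text \<open>Riesz representation for each fixed \<open>x\<close> gives the value \<open>g x\<close>.
  Boundedness follows by testing the defining identity at \<open>y = g x\<close> and cancelling one
  factor \<open>norm (g x)\<close>.\<close>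

lemma adjoint_exists:
  fixes A :: "'h::complex_hilbert_space \<Rightarrow>\<^sub>L 'h"
  assumes A: "A \<in> bounded_ops"
  shows "\<exists>B\<in>bounded_ops. \<forall>x y. cinner (B x) y = cinner x (A y)"
proof -
  have "\<exists>z. \<forall>y. cinner x (A y) = cinner z y" for x
  proof (rule riesz_representation)
    show "bounded_linear (\<lambda>y. cinner x (A y))"
      by (rule bounded_linear_compose[OF bounded_bilinear.bounded_linear_right[OF
            bounded_bilinear_cinner] blinfun.bounded_linear_right])
  qed (simp add: bounded_ops_scaleC[OF A] cinner_scaleC_right)
  then obtain g where g: "\<And>x y. cinner (g x) y = cinner x (A y)" by metis
  have "bounded_linear g"
  proof (rule bounded_linear_intro)
    show "g (x + y) = g x + g y" for x y
      by (rule cinner_eq_left_imp_eq) (simp add: g cinner_simps)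
    show "g (r *\<^sub>R x) = r *\<^sub>R g x" for r x
      by (rule cinner_eq_left_imp_eq) (simp add: g cinner_simps)
    show "norm (g x) \<le> norm x * norm A" for x
    proof (cases "g x = 0")
      case False
      have "(norm (g x))\<^sup>2 = cmod (cinner x (A (g x)))"
        unfolding g[symmetric] cinner_self_eq_norm by (simp add: norm_power)
      also have "\<dots> \<le> norm x * (norm A * norm (g x))"
        by (rule order_trans[OF cauchy_schwarz]) (simp add: mult_left_mono norm_blinfun)
      finally have "norm (g x) * norm (g x) \<le> (norm x * norm A) * norm (g x)"
        by (simp add: power2_eq_square mult.assoc)
      thus ?thesis using False by (simp add: mult_le_cancel_right)
    qed simp
  qed
  hence app: "blinfun_apply (Blinfun g) = g" by (rule bounded_linear_Blinfun_apply)
  have "g (c *\<^sub>C x) = c *\<^sub>C g x" for c x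
    by (rule cinner_eq_left_imp_eq) (simp add: g cinner_simps)
  hence "Blinfun g \<in> bounded_ops" by (simp add: bounded_ops_def app)
  thus ?thesis using g app by metis
qed

lemma adj_props:
  assumes "A \<in> bounded_ops"
  shows adj_in_bounded_ops: "adj A \<in> bounded_ops"
    and cinner_adj_left: "cinner (adj A x) y = cinner x (A y)"
    and cinner_adj_right: "cinner x (adj A y) = cinner (A x) y"
proof -
  obtain B where B: "B \<in> bounded_ops" "\<And>x y. cinner (B x) y = cinner x (A y)"
    using adjoint_exists[OF assms] by blast
  have "adj A = B" by (rule adj_eqI[OF B])
  thus "adj A \<in> bounded_ops" and *: "cinner (adj A x) y = cinner x (A y)" for x y
    using B by auto
  show "cinner x (adj A y) = cinner (A x) y"
    by (metis * cinner_commute)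
qed

lemma adj_compose:
  assumes "A \<in> bounded_ops" "B \<in> bounded_ops"
  shows "adj (A o\<^sub>L B) = adj B o\<^sub>L adj A"
  by (rule adj_eqI) (use assms in \<open>auto intro!: compose_in_bounded_ops adj_in_bounded_ops
    simp: cinner_adj_left\<close>)

lemma adj_adj: "A \<in> bounded_ops \<Longrightarrow> adj (adj A) = A"
  by (rule adj_eqI) (auto simp: cinner_adj_right)

lemma adj_diff:
  "A \<in> bounded_ops \<Longrightarrow> B \<in> bounded_ops \<Longrightarrow> adj (A - B) = adj A - adj B"
  by (rule adj_eqI) (auto intro!: diff_in_bounded_ops adj_in_bounded_ops
    simp: blinfun.diff_left cinner_simps cinner_adj_left)

lemma adj_id: "adj id_blinfun = id_blinfun"
  by (rule adj_eqI) (auto simp: id_in_bounded_ops)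

lemma norm_adj_le:
  assumes "A \<in> bounded_ops"
  shows "norm (adj A) \<le> norm A"
proof (rule norm_blinfun_bound)
  fix x
  have "(norm (adj A x))\<^sup>2 = cmod (cinner x (A (adj A x)))"
    unfolding cinner_adj_left[OF assms, symmetric] cinner_self_eq_norm by (simp add: norm_power)
  also have "\<dots> \<le> norm x * (norm A * norm (adj A x))"
    by (rule order_trans[OF cauchy_schwarz]) (simp add: mult_left_mono norm_blinfun)
  finally have "norm (adj A x) * norm (adj A x) \<le> (norm A * norm x) * norm (adj A x)"
    by (simp add: power2_eq_square mult_ac)
  thus "norm (adj A x) \<le> norm A * norm x"
    by (cases "adj A x = 0") (auto simp: mult_le_cancel_right)
qed simp

section \<open>Orthogonal projections and their ranges\<close>

lemma projectionD:
  assumes "projection P"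
  shows "P \<in> bounded_ops" "P (P x) = P x" "adj P = P" "cinner (P x) y = cinner x (P y)"
  using assms cinner_adj_left[of P x y] unfolding projection_def
  by auto (metis blinfun_apply_blinfun_compose)

lemma projection_complement:
  assumes "projection P"
  shows "projection (id_blinfun - P)"
  unfolding projection_def using projectionD[OF assms]
  by (auto simp: id_in_bounded_ops diff_in_bounded_ops adj_diff adj_id blinfun.diff_left
      blinfun.diff_right intro!: blinfun_eqI)

lemma projection_range_iff:
  assumes "projection P"
  shows "x \<in> range P \<longleftrightarrow> P x = x"
  using projectionD(2)[OF assms] by (metis rangeE rangeI)

lemma closed_range_projection:
  assumes "projection P"
  shows "closed (range P)"
proof -
  have "range P = {x. P x = x}" using projection_range_iff[OF assms] by blast
  thus ?thesis by (simp add: closed_Collect_eq continuous_intros)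
qed

lemma norm_projection_le:
  assumes "projection P"
  shows "norm (P x) \<le> norm x"
proof -
  have "(norm x)\<^sup>2 = (norm (P x))\<^sup>2 + 2 * Re (cinner (P x) (x - P x)) + (norm (x - P x))\<^sup>2"
    using norm_add_squared[of "P x" "x - P x"] by simp
  moreover have "cinner (P x) (x - P x) = 0"
    by (simp add: projectionD[OF assms] blinfun.diff_right)
  ultimately have "(norm (P x))\<^sup>2 \<le> (norm x)\<^sup>2" by simp
  thus ?thesis by (simp add: power2_le_iff_abs_le)
qed

text \<open>Orthogonality of \<open>x - p\<close> to \<open>S\<close> determines \<open>p\<close> in
  \<open>S\<close>, and this condition is preserved by sums and multiples; linearity of the chosen
  map \<open>g\<close> follows from uniqueness.\<close>

lemma projection_onto_exists:
  fixes S :: "'h::complex_hilbert_space set"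
  assumes S: "complex_subspace S" "closed S"
  shows "\<exists>P. projection P \<and> range P = S"
proof -
  obtain g where g: "\<And>x. g x \<in> S" and orth: "\<And>s x. s \<in> S \<Longrightarrow> cinner s (x - g x) = 0"
    using orthogonal_decomposition[OF S] by metis
  have uniq: "g x = p" if "p \<in> S" "\<And>s. s \<in> S \<Longrightarrow> cinner s (x - p) = 0" for x p
  proof -
    have "g x - p \<in> S" using complex_subspace_diff[OF S(1)] g that by blast
    hence "cinner (g x - p) ((x - p) - (x - g x)) = 0"
      unfolding cinner_diff_right[of _ "x - p"] using that(2) orth by simp
    thus ?thesis by (simp add: cinner_eq_zero_iff)
  qed
  have scale: "g (c *\<^sub>C x) = c *\<^sub>C g x" for c x
  proof (rule uniq)
    fix s assume "s \<in> S"
    have "c *\<^sub>C x - c *\<^sub>C g x = c *\<^sub>C (x - g x)"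
      using scaleC_add_right[of c "x - g x" "g x"] by (simp add: algebra_simps)
    thus "cinner s (c *\<^sub>C x - c *\<^sub>C g x) = 0"
      by (simp only:) (simp add: cinner_scaleC_right orth[OF \<open>s \<in> S\<close>])
  qed (use S g in \<open>auto simp: complex_subspace_def\<close>)
  have "bounded_linear g"
  proof (rule bounded_linear_intro)
    show "g (x + y) = g x + g y" for x y
    proof (rule uniq)
      fix s assume "s \<in> S"
      thus "cinner s (x + y - (g x + g y)) = 0"
        using orth[of s x] orth[of s y] by (simp add: cinner_simps)
    qed (use S g in \<open>auto simp: complex_subspace_def\<close>)
    show "g (r *\<^sub>R x) = r *\<^sub>R g x" for r x by (simp add: scaleR_scaleC scale)
    show "norm (g x) \<le> norm x * 1" for x
    proof -
      have "(norm x)\<^sup>2 = (norm (g x))\<^sup>2 + 2 * Re (cinner (g x) (x - g x)) + (norm (x - g x))\<^sup>2"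
        using norm_add_squared[of "g x" "x - g x"] by simp
      hence "(norm (g x))\<^sup>2 \<le> (norm x)\<^sup>2" by (simp add: orth g)
      thus ?thesis by (simp add: power2_le_iff_abs_le)
    qed
  qed
  hence app: "blinfun_apply (Blinfun g) = g" by (rule bounded_linear_Blinfun_apply)
  have bo: "Blinfun g \<in> bounded_ops" by (simp add: bounded_ops_def app scale)
  have gid: "g p = p" if "p \<in> S" for p using uniq[OF that] by simp
  have "cinner (g x) y = cinner x (g y)" for x y
  proof -
    have "cinner (g x) (y - g y) = 0" "cinner (g y) (x - g x) = 0" using orth g by auto
    hence "cinner (g x) y = cinner (g x) (g y)" "cinner (g y) x = cinner (g y) (g x)"
      by (auto simp: cinner_simps)
    thus ?thesis by (metis cinner_commute)
  qed
  hence "adj (Blinfun g) = Blinfun g" by (intro adj_eqI) (auto simp: app bo)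
  moreover have "Blinfun g o\<^sub>L Blinfun g = Blinfun g"
    by (rule blinfun_eqI) (simp add: app gid g)
  moreover have "range g = S" using g gid by (metis image_subset_iff rangeI subsetI subset_antisym)
  ultimately show ?thesis using bo app unfolding projection_def by metis
qed

text \<open>Equal ranges give \<open>P Q = Q\<close> and \<open>Q P = P\<close>, and taking adjoints
  exchanges the factors.\<close>

lemma projection_unique:
  assumes P: "projection P" and Q: "projection Q" and eq: "range P = range Q"
  shows "P = Q"
proof -
  have PQ: "P (Q x) = Q x" and QP: "Q (P x) = P x" for x
    using projection_range_iff[OF P] projection_range_iff[OF Q] eq by (metis rangeI)+
  have "P x = Q x" for x
  proof (rule cinner_eq_right_imp_eq)
    show "cinner z (P x) = cinner z (Q x)" for z
      by (metis PQ QP projectionD(4)[OF P] projectionD(4)[OF Q])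
  qed
  thus ?thesis by (rule blinfun_eqI)
qed

lemma complex_subspace_closure:
  fixes S :: "'h::complex_hilbert_space set"
  assumes S: "complex_subspace S"
  shows "complex_subspace (closure S)"
  unfolding complex_subspace_def
proof (intro conjI ballI allI)
  show "0 \<in> closure S"
    using S by (auto simp: complex_subspace_def intro: subsetD[OF closure_subset])
next
  fix x y assume xy: "x \<in> closure S" "y \<in> closure S"
  obtain f where f: "\<forall>n. f n \<in> S" "f \<longlonglongrightarrow> x"
    using xy(1) unfolding closure_sequential by (elim exE conjE)
  obtain g where g: "\<forall>n. g n \<in> S" "g \<longlonglongrightarrow> y"
    using xy(2) unfolding closure_sequential by (elim exE conjE)
  have "\<forall>n. f n + g n \<in> S"
    using f(1) g(1) S by (auto simp: complex_subspace_def)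
  moreover have "(\<lambda>n. f n + g n) \<longlonglongrightarrow> x + y" by (intro tendsto_add f g)
  ultimately show "x + y \<in> closure S"
    unfolding closure_sequential by (intro exI[of _ "\<lambda>n. f n + g n"] conjI)
next
  fix c x assume x: "x \<in> closure S"
  have "(\<lambda>x. c *\<^sub>C x) ` S \<subseteq> S" using S by (auto simp: complex_subspace_def)
  hence "(\<lambda>x. c *\<^sub>C x) ` closure S \<subseteq> closure S"
    using closure_bounded_linear_image_subset[OF bounded_linear_scaleC, of c S] closure_mono
    by blast
  thus "c *\<^sub>C x \<in> closure S" using imageI[OF x] by (rule subsetD)
qed

lemma complex_subspace_range:
  fixes A :: "'h::complex_hilbert_space \<Rightarrow>\<^sub>L 'h"
  assumes A: "A \<in> bounded_ops"
  shows "complex_subspace (range A)"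
  unfolding complex_subspace_def
proof (intro conjI ballI allI)
  show "0 \<in> range A" by (rule range_eqI[of _ _ 0]) simp
  show "x + y \<in> range A" if "x \<in> range A" "y \<in> range A" for x y
    using that by (auto simp flip: blinfun.add_right)
  show "c *\<^sub>C x \<in> range A" if "x \<in> range A" for c x
    using that by (auto simp: bounded_ops_scaleC[OF A, symmetric])
qed

lemma range_projection_props:
  assumes "A \<in> bounded_ops"
  shows projection_range_projection: "projection (range_projection A)"
    and range_range_projection: "range (range_projection A) = closure (range A)"
proof -
  have "\<exists>!P. projection P \<and> range P = closure (range A)"
  proof (rule ex_ex1I)
    show "\<exists>P. projection P \<and> range P = closure (range A)"
      by (rule projection_onto_exists[OF complex_subspace_closure[OF complex_subspace_range[OF assms]] closed_closure])
    show "P = Q" if "projection P \<and> range P = closure (range A)"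
      "projection Q \<and> range Q = closure (range A)" for P Q
      using that by (intro projection_unique) simp_all
  qed
  from theI'[OF this] show "projection (range_projection A)"
    "range (range_projection A) = closure (range A)"
    unfolding range_projection_def by simp_all
qed

text \<open>For \<open>x\<close> fixed by \<open>P\<close>, positivity of \<open>Q - P\<close> at
  \<open>x\<close> says that the component of \<open>x\<close> outside the range of \<open>Q\<close>
  has nonpositive squared norm. This turns range contractivity into an inclusion of closed
  ranges.\<close>

lemma op_le_projection_imp_range_subset:
  assumes P: "projection P" and Q: "projection Q" and le: "op_le P Q"
  shows "range P \<subseteq> range Q"
proof
  fix x assume "x \<in> range P"
  hence x: "P x = x" using projection_range_iff[OF P] by blast
  define r where "r = x - Q x"
  have "cinner x ((Q - P) x) \<in> \<real>\<^sub>\<ge>\<^sub>0" using le by (simp add: op_le_def)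
  hence "Re (cinner x (Q x - x)) \<ge> 0"
    by (simp add: blinfun.diff_left x complex_nonneg_Reals_iff)
  moreover have "cinner r r = - cinner x (Q x - x)"
    by (simp add: r_def cinner_simps projectionD[OF Q])
  ultimately have "Re (cinner r r) \<le> 0" by simp
  hence "r = 0" by (simp flip: norm_squared_eq_cinner)
  thus "x \<in> range Q" by (simp add: r_def projection_range_iff[OF Q])
qed

text \<open>Invariance under \<open>A\<close> reads \<open>A Q = Q A Q\<close>; invariance under
  \<open>adj A\<close> reads, after taking adjoints, \<open>Q A = Q A Q\<close>.\<close>

lemma projection_commutes_if_invariant:
  assumes Q: "projection Q" and A: "A \<in> bounded_ops"
    and inv: "\<And>x. x \<in> range Q \<Longrightarrow> A x \<in> range Q" "\<And>x. x \<in> range Q \<Longrightarrow> adj A x \<in> range Q"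
  shows "A o\<^sub>L Q = Q o\<^sub>L A"
proof (rule blinfun_eqI)
  fix x
  have 1: "Q (A (Q x)) = A (Q x)" and 2: "Q (adj A (Q y)) = adj A (Q y)" for x y
    by (simp_all add: inv flip: projection_range_iff[OF Q])
  have "Q (A (Q x)) = Q (A x)"
  proof (rule cinner_eq_right_imp_eq)
    show "cinner z (Q (A (Q x))) = cinner z (Q (A x))" for z
      by (metis 2 cinner_adj_left[OF A] projectionD(4)[OF Q])
  qed
  thus "(A o\<^sub>L Q) x = (Q o\<^sub>L A) x" by (simp add: 1)
qed

text \<open>Both sides say that \<open>x\<close> is orthogonal to the range of \<open>T\<close>;
  closedness of the orthogonality condition passes it to the closure.\<close>

lemma range_projection_eq_0_iff:
  fixes T :: "'h::complex_hilbert_space \<Rightarrow>\<^sub>L 'h"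
  assumes T: "T \<in> bounded_ops"
  shows "range_projection T x = 0 \<longleftrightarrow> adj T x = 0"
proof
  note Q = projection_range_projection[OF T] and rQ = range_range_projection[OF T]
  assume 0: "range_projection T x = 0"
  have "cinner z (adj T x) = 0" for z
  proof -
    have "T z \<in> range (range_projection T)"
      unfolding rQ by (rule subsetD[OF closure_subset]) simp
    hence "range_projection T (T z) = T z" using projection_range_iff[OF Q] by simp
    hence "cinner (T z) x = cinner (T z) (range_projection T x)"
      by (simp flip: projectionD(4)[OF Q])
    thus ?thesis by (simp add: cinner_adj_right[OF T] 0)
  qed
  thus "adj T x = 0" using cinner_eq_zero_iff by blast
next
  note Q = projection_range_projection[OF T] and rQ = range_range_projection[OF T]
  assume 0: "adj T x = 0"
  have "range T \<subseteq> {z. cinner z x = 0}"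
    using 0 by (auto simp: cinner_adj_right[OF T, symmetric])
  moreover have "closed {z. cinner z x = 0}"
    by (intro closed_Collect_eq continuous_on_cinner continuous_intros)
  ultimately have "closure (range T) \<subseteq> {z. cinner z x = 0}" by (rule closure_minimal)
  moreover have "range_projection T x \<in> closure (range T)" unfolding rQ[symmetric] by simp
  ultimately have "cinner (range_projection T x) x = 0" by blast
  hence "cinner (range_projection T (range_projection T x)) x = 0"
    by (simp add: projectionD(2)[OF Q])
  hence "cinner (range_projection T x) (range_projection T x) = 0"
    by (simp only: projectionD(4)[OF Q])
  thus "range_projection T x = 0" by (simp add: cinner_eq_zero_iff)
qed

section \<open>Kernel projections in von Neumann algebras\<close>

text \<open>\<open>B\<^sup>*B\<close> is self-adjoint with the same kernel as \<open>B\<close>, and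
  for a self-adjoint operator the kernel is the orthogonal complement of the range.\<close>

definition kernel_projection :: "('h::complex_hilbert_space \<Rightarrow>\<^sub>L 'h) \<Rightarrow> ('h \<Rightarrow>\<^sub>L 'h)" where
  "kernel_projection B = id_blinfun - range_projection (adj B o\<^sub>L B)"

lemma
  fixes B :: "'h::complex_hilbert_space \<Rightarrow>\<^sub>L 'h"
  assumes B: "B \<in> bounded_ops"
  shows projection_kernel_projection: "projection (kernel_projection B)"
    and kernel_projection_fixes_iff: "kernel_projection B x = x \<longleftrightarrow> B x = 0"
    and apply_kernel_projection: "B (kernel_projection B x) = 0"
proof -
  define T where "T = adj B o\<^sub>L B"
  have T: "T \<in> bounded_ops" "adj T = T"
    using B by (simp_all add: T_def adj_compose adj_adj adj_in_bounded_ops compose_in_bounded_ops)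
  show proj: "projection (kernel_projection B)"
    unfolding kernel_projection_def T_def[symmetric]
    by (rule projection_complement[OF projection_range_projection[OF T(1)]])
  show iff: "kernel_projection B x = x \<longleftrightarrow> B x = 0" for x
  proof -
    have "kernel_projection B x = x \<longleftrightarrow> T x = 0"
      using range_projection_eq_0_iff[OF T(1), of x]
      by (simp add: kernel_projection_def T_def[symmetric] blinfun.diff_left T(2))
    also have "\<dots> \<longleftrightarrow> B x = 0"
    proof
      assume "T x = 0"
      hence "cinner x (T x) = 0" by simp
      hence "cinner (B x) (B x) = 0" by (simp add: T_def cinner_adj_right[OF B])
      thus "B x = 0" by (simp add: cinner_eq_zero_iff)
    qed (simp add: T_def)
    finally show ?thesis .
  qed
  show "B (kernel_projection B x) = 0"
    using iff[of "kernel_projection B x"] projectionD(2)[OF proj] by simp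
qed

section \<open>Closure properties of a von Neumann algebra\<close>

locale von_neumann =
  fixes M :: "('h::complex_hilbert_space \<Rightarrow>\<^sub>L 'h) set"
  assumes von_neumann: "von_neumann_algebra M"
begin

lemma bounded_ops: "A \<in> M \<Longrightarrow> A \<in> bounded_ops"
  and id_in: "id_blinfun \<in> M"
  and add_in: "A \<in> M \<Longrightarrow> B \<in> M \<Longrightarrow> A + B \<in> M"
  and scaleC_in: "A \<in> M \<Longrightarrow> op_scaleC c A \<in> M"
  and compose_in: "A \<in> M \<Longrightarrow> B \<in> M \<Longrightarrow> A o\<^sub>L B \<in> M"
  and adj_in: "A \<in> M \<Longrightarrow> adj A \<in> M"
  using von_neumann unfolding von_neumann_algebra_def by blast+

lemma scaleR_in: "A \<in> M \<Longrightarrow> r *\<^sub>R A \<in> M"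
proof -
  have "r *\<^sub>R A = op_scaleC (complex_of_real r) A"
    by (rule blinfun_eqI) (simp add: op_scaleC.rep_eq blinfun.scaleR_left scaleR_scaleC)
  thus "A \<in> M \<Longrightarrow> r *\<^sub>R A \<in> M" by (simp add: scaleC_in)
qed

lemma diff_in: "A \<in> M \<Longrightarrow> B \<in> M \<Longrightarrow> A - B \<in> M"
  using add_in[OF _ scaleR_in[of B "-1"], of A] by simp

lemma zero_in: "0 \<in> M"
  using diff_in[OF id_in id_in] by simp

lemma sum_in: "(\<And>i. i \<in> I \<Longrightarrow> f i \<in> M) \<Longrightarrow> sum f I \<in> M"
  by (induction I rule: infinite_finite_induct) (auto simp: zero_in add_in)

text \<open>Pointwise norm convergence implies convergence of all matrix coefficients, and
  \<open>M\<close> is closed for the latter. A general filter is allowed because one application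
  runs over the finite subsets of a possibly uncountable set.\<close>

lemma strong_limit_in:
  assumes F: "F \<noteq> bot" and T: "\<forall>\<^sub>F i in F. T i \<in> M"
    and lim: "\<And>y. ((\<lambda>i. blinfun_apply (T i) y) \<longlongrightarrow> blinfun_apply S y) F"
  shows "S \<in> M"
proof (rule ccontr)
  assume notin: "S \<notin> M"
  \<comment> \<open>The topology lives on \<open>bounded_ops\<close> only, so complex linearity of
    the limit has to be secured before closedness can be applied.\<close>
  have "S (c *\<^sub>C x) = c *\<^sub>C S x" for c x
  proof (rule tendsto_unique[OF F lim])
    have "((\<lambda>i. c *\<^sub>C T i x) \<longlongrightarrow> c *\<^sub>C S x) F"
      by (intro bounded_linear.tendsto[OF bounded_linear_scaleC] lim)
    moreover have "\<forall>\<^sub>F i in F. c *\<^sub>C T i x = T i (c *\<^sub>C x)"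
      using T by eventually_elim (simp add: bounded_ops_scaleC[OF bounded_ops])
    ultimately show "((\<lambda>i. T i (c *\<^sub>C x)) \<longlongrightarrow> c *\<^sub>C S x) F"
      using tendsto_cong by fast
  qed
  hence S: "S \<in> bounded_ops" by (simp add: bounded_ops_def)
  define f where "f = (\<lambda>A::'h \<Rightarrow>\<^sub>L 'h. \<lambda>(x, y). cinner x (A y))"
  have "closedin weak_operator_topology M"
    using von_neumann by (simp add: von_neumann_algebra_def)
  hence "openin weak_operator_topology (bounded_ops - M)"
    by (simp add: closedin_def weak_operator_topology_def topspace_pullback_topology)
  then obtain U where U: "open U" "bounded_ops - M = f -` U \<inter> bounded_ops"
    unfolding weak_operator_topology_def openin_pullback_topology f_def
    by auto
  have "((\<lambda>i. f (T i)) \<longlongrightarrow> f S) F"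
  proof -
    have "limitin (product_topology (\<lambda>_. euclidean) UNIV) (\<lambda>i. f (T i)) (f S) F"
      unfolding limitin_componentwise
      by (auto simp: f_def intro!: tendsto_cinner lim)
    thus ?thesis by (simp add: euclidean_product_topology)
  qed
  moreover have "f S \<in> U" using S notin U by blast
  ultimately have "\<forall>\<^sub>F i in F. f (T i) \<in> U" using U(1) topological_tendstoD by blast
  hence "\<forall>\<^sub>F i in F. False" using T by eventually_elim (use U(2) bounded_ops in blast)
  thus False using F by (simp add: eventually_False)
qed

lemma norm_limit_in:
  assumes "\<And>n::nat. T n \<in> M" "T \<longlonglongrightarrow> S"
  shows "S \<in> M"
  by (rule strong_limit_in[of sequentially T])
    (use assms in \<open>auto intro!: blinfun.tendsto tendsto_const\<close>)

text \<open>Mean ergodic theorem: the Cesaro means of the contraction \<open>I - B\<^sup>*B / c\<close> converge strongly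
  to the projection onto its fixed points, the kernel of \<open>B\<close>.\<close>

lemma kernel_projection_in:
  assumes B: "B \<in> M"
  shows "kernel_projection B \<in> M"
proof -
  note Bb = bounded_ops[OF B]
  define T where "T = adj B o\<^sub>L B"
  define Q where "Q = range_projection T"
  \<comment> \<open>\<open>c\<close> dominates the norm of \<open>T\<close>, and the added 1 keeps
    it positive when \<open>B = 0\<close>.\<close>
  define c where "c = (norm B)\<^sup>2 + 1"
  have c: "c > 0" "(norm B)\<^sup>2 \<le> c" by (auto simp: c_def add_nonneg_pos)
  define U where "U = id_blinfun - (1 / c) *\<^sub>R T"
  define p where "p n = (((o\<^sub>L) U) ^^ n) id_blinfun" for n
  define V where "V n = (1 / real n) *\<^sub>R (\<Sum>k<n. p k)" for n
  have TM: "T \<in> M" unfolding T_def by (intro compose_in adj_in B)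
  have UM: "U \<in> M" unfolding U_def by (intro diff_in id_in scaleR_in TM)
  have pM: "p n \<in> M" for n by (induction n) (auto simp: p_def id_in intro: compose_in UM)
  have VM: "V n \<in> M" for n unfolding V_def by (intro scaleR_in sum_in pM)
  \<comment> \<open>In the expanded square the cross term removes \<open>2 |B x|^2 / c\<close>,
    while the choice of \<open>c\<close> bounds the quadratic term by
    \<open>|B x|^2 / c\<close>.\<close>
  have U_le: "norm (U x) \<le> norm x" for x
  proof -
    have tx: "cinner x (T x) = complex_of_real ((norm (B x))\<^sup>2)"
      by (simp add: T_def cinner_adj_right[OF Bb] cinner_self_eq_norm)
    have "norm (T x) \<le> norm B * norm (B x)"
      unfolding T_def blinfun_apply_blinfun_compose
      by (rule order_trans[OF norm_blinfun]) (simp add: mult_right_mono norm_adj_le[OF Bb])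
    hence "(norm (T x))\<^sup>2 \<le> (norm B * norm (B x))\<^sup>2" by (intro power_mono) auto
    also have "\<dots> \<le> c * (norm (B x))\<^sup>2"
      using c by (simp add: power_mult_distrib mult_right_mono)
    finally have T2: "(norm (T x))\<^sup>2 \<le> c * (norm (B x))\<^sup>2" .
    have "(norm (U x))\<^sup>2 = (norm x)\<^sup>2 - 2 * ((norm (B x))\<^sup>2 / c) + (norm (T x))\<^sup>2 / c\<^sup>2"
      unfolding U_def blinfun.diff_left blinfun.scaleR_left norm_diff_squared
      by (simp add: cinner_scaleR_right tx power_divide)
    also have "(norm (T x))\<^sup>2 / c\<^sup>2 \<le> (norm (B x))\<^sup>2 / c"
      using T2 c by (simp add: field_simps power2_eq_square)
    finally have "(norm (U x))\<^sup>2 \<le> (norm x)\<^sup>2 - (norm (B x))\<^sup>2 / c" by simp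
    also have "\<dots> \<le> (norm x)\<^sup>2" using c by simp
    finally show ?thesis by (simp add: power2_le_iff_abs_le)
  qed
  have p_le: "norm (p n x) \<le> norm x" for n x
    by (induction n) (auto simp: p_def intro: order_trans[OF U_le])
  have V_apply: "V n x = (1 / real n) *\<^sub>R (\<Sum>k<n. p k x)" for n x
    by (simp add: V_def blinfun.scaleR_left blinfun.sum_left)
  have V_le: "norm (V n x) \<le> norm x" for n x
  proof -
    have "norm (\<Sum>k<n. p k x) \<le> real n * norm x"
      using sum_norm_le[of "{..<n}" "\<lambda>k. p k x" "\<lambda>_. norm x"] p_le by simp
    thus ?thesis unfolding V_apply by (cases "n = 0") (auto simp: field_simps)
  qed
  have U_T: "U z = z - (1 / c) *\<^sub>R T z" for z
    by (simp add: U_def blinfun.diff_left blinfun.scaleR_left)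
  have V_range: "(\<lambda>n. V n (T z)) \<longlonglongrightarrow> 0" for z
  proof (rule Lim_null_comparison)
    have comm: "p k (U z) = U (p k z)" for k z
      by (induction k) (auto simp: p_def)
    \<comment> \<open>On the range of \<open>T\<close> the sum of the powers telescopes, so its mean
      is of order \<open>1 / n\<close>.\<close>
    have "T z = c *\<^sub>R (z - U z)" using c by (simp add: U_T)
    hence "p k (T z) = c *\<^sub>R (p k z - p (Suc k) z)" for k
      by (simp add: blinfun.scaleR_right blinfun.diff_right comm) (simp add: p_def)
    hence "(\<Sum>k<n. p k (T z)) = c *\<^sub>R (p 0 z - p n z)" for n
      by (simp add: sum_lessThan_telescope'[where f = "\<lambda>k. p k z"] flip: scaleR_sum_right)
    hence eq: "V n (T z) = (c / real n) *\<^sub>R (z - p n z)" for n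
      by (simp add: V_apply p_def)
    have "norm (V n (T z)) \<le> (c / real n) * (norm z + norm z)" for n
    proof -
      have "norm (z - p n z) \<le> norm z + norm z"
        using p_le[of n z] norm_triangle_ineq4[of z "p n z"] by linarith
      hence "(c / real n) * norm (z - p n z) \<le> (c / real n) * (norm z + norm z)"
        using c by (intro mult_left_mono) auto
      thus ?thesis using c by (simp add: eq)
    qed
    thus "\<forall>\<^sub>F n in sequentially. norm (V n (T z)) \<le> (c / real n) * (norm z + norm z)"
      by simp
    show "(\<lambda>n. (c / real n) * (norm z + norm z)) \<longlonglongrightarrow> 0"
      by (intro tendsto_mult_left_zero lim_const_over_n)
  qed
  \<comment> \<open>The uniform bound \<open>V_le\<close> extends the convergence from the range of
    \<open>T\<close> to its closure.\<close>
  have V_closure: "(\<lambda>n. V n y) \<longlonglongrightarrow> 0" if y: "y \<in> closure (range T)" for y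
  proof (rule tendstoI)
    fix e :: real assume "e > 0"
    then obtain z where z: "dist (T z) y < e / 2"
      using y unfolding closure_approachable by (metis half_gt_zero rangeE)
    have "\<forall>\<^sub>F n in sequentially. dist (V n (T z)) 0 < e / 2"
      using V_range[of z] \<open>e > 0\<close> by (intro tendstoD) auto
    thus "\<forall>\<^sub>F n in sequentially. dist (V n y) 0 < e"
    proof eventually_elim
      case (elim n)
      have "norm (V n y) \<le> norm (V n (T z)) + norm (V n (y - T z))"
        using norm_triangle_ineq[of "V n (T z)" "V n (y - T z)"] by (simp add: blinfun.diff_right)
      also have "norm (V n (y - T z)) \<le> norm (y - T z)" by (rule V_le)
      finally show ?case using elim z by (simp add: dist_norm norm_minus_commute)
    qed
  qed
  have T: "T \<in> bounded_ops" "adj T = T"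
    using Bb by (simp_all add: T_def adj_compose adj_adj adj_in_bounded_ops compose_in_bounded_ops)
  note Q = projection_range_projection[OF T(1), folded Q_def]
  have "(\<lambda>n. V n x) \<longlonglongrightarrow> (id_blinfun - Q) x" for x
  proof -
    have "Q (x - Q x) = 0" by (simp add: blinfun.diff_right projectionD(2)[OF Q])
    hence "T (x - Q x) = 0"
      using range_projection_eq_0_iff[OF T(1)] by (simp add: Q_def T(2))
    hence "U (x - Q x) = x - Q x" by (simp add: U_T)
    hence "p k (x - Q x) = x - Q x" for k by (induction k) (auto simp: p_def)
    \<comment> \<open>At \<open>n = 0\<close> the mean is an empty sum times
      \<open>1 / 0 = 0\<close>, so fixed points are reproduced only for positive
      \<open>n\<close>.\<close>
    hence "V n (x - Q x) = x - Q x" if "n > 0" for n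
      using that by (simp add: V_apply sum_constant_scaleR)
    hence ev: "\<forall>\<^sub>F n in sequentially. (x - Q x) + V n (Q x) = V n x"
      by (intro eventually_mono[OF eventually_gt_at_top[of 0]])
        (metis blinfun.diff_right diff_add_cancel)
    have "Q x \<in> closure (range T)"
      unfolding range_range_projection[OF T(1), symmetric] Q_def by simp
    hence "(\<lambda>n. (x - Q x) + V n (Q x)) \<longlonglongrightarrow> (x - Q x) + 0"
      by (intro tendsto_intros V_closure)
    thus ?thesis using tendsto_cong[OF ev] by (simp add: blinfun.diff_left)
  qed
  hence "id_blinfun - Q \<in> M" by (intro strong_limit_in[of sequentially V]) (auto simp: VM)
  thus ?thesis by (simp add: kernel_projection_def Q_def T_def)
qed

text \<open>For a finite \<open>F\<close> the common kernel is the kernel of the single positive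
  operator \<open>T F\<close>, so its projection is in \<open>M\<close>. These projections decrease
  along the net of finite subsets of \<open>N\<close>, and a decreasing net of projections converges
  strongly to the projection onto the intersection of the ranges.\<close>

lemma projection_onto_common_kernel_in:
  assumes N: "N \<subseteq> M" and P: "projection P" "range P = {x. \<forall>B\<in>N. B x = 0}"
  shows "P \<in> M"
proof -
  define T where "T F = (\<Sum>B\<in>F. adj B o\<^sub>L B)" for F :: "('h \<Rightarrow>\<^sub>L 'h) set"
  define Z where "Z F = kernel_projection (T F)" for F
  have TM: "T F \<in> M" if "F \<subseteq> N" for F
    unfolding T_def using that N by (intro sum_in compose_in adj_in) auto
  have ZM: "Z F \<in> M" if "F \<subseteq> N" for F unfolding Z_def by (intro kernel_projection_in TM that)
  have Zp: "projection (Z F)" if "F \<subseteq> N" for F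
    unfolding Z_def by (intro projection_kernel_projection bounded_ops TM that)
  have Tker: "T F x = 0 \<longleftrightarrow> (\<forall>B\<in>F. B x = 0)" if F: "F \<subseteq> N" "finite F" for F x
  proof
    assume 0: "T F x = 0"
    have "cinner x (T F x) = (\<Sum>B\<in>F. cinner x (adj B (blinfun_apply B x)))"
      by (simp add: T_def blinfun.sum_left bounded_bilinear.sum_right[OF bounded_bilinear_cinner])
    also have "\<dots> = (\<Sum>B\<in>F. complex_of_real ((norm (blinfun_apply B x))\<^sup>2))"
    proof (rule sum.cong[OF refl])
      fix B assume "B \<in> F"
      hence "B \<in> bounded_ops" using F N bounded_ops by blast
      thus "cinner x (adj B (B x)) = complex_of_real ((norm (B x))\<^sup>2)"
        by (simp add: cinner_adj_right cinner_self_eq_norm)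
    qed
    finally have "complex_of_real (\<Sum>B\<in>F. (norm (blinfun_apply B x))\<^sup>2) = 0" using 0 by simp
    hence "(\<Sum>B\<in>F. (norm (blinfun_apply B x))\<^sup>2) = 0" by (simp only: of_real_eq_0_iff)
    thus "\<forall>B\<in>F. B x = 0" using F(2) by (simp add: sum_nonneg_eq_0_iff)
  qed (simp add: T_def blinfun.sum_left)
  have Zfix: "Z F x = x \<longleftrightarrow> (\<forall>B\<in>F. B x = 0)" if F: "F \<subseteq> N" "finite F" for F x
    unfolding Z_def using Tker[OF F] kernel_projection_fixes_iff[OF bounded_ops[OF TM[OF F(1)]]]
    by simp
  \<comment> \<open>A larger set has a smaller common kernel, so \<open>Z F\<close> fixes the range
    of \<open>Z G\<close>; the adjoint of that identity is the claim.\<close>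
  have ZZ: "Z G (Z F x) = Z G x" if FG: "F \<subseteq> G" "G \<subseteq> N" "finite G" for F G x
  proof (rule cinner_eq_right_imp_eq)
    fix y
    have F: "F \<subseteq> N" "finite F" using FG finite_subset by auto
    have "Z G (Z G y) = Z G y" by (rule projectionD(2)[OF Zp[OF FG(2)]])
    hence "Z F (Z G y) = Z G y" using Zfix FG F by blast
    thus "cinner y (Z G (Z F x)) = cinner y (Z G x)"
      by (metis F(1) FG(2) Zp projectionD(4))
  qed
  define U where "U = {x. \<exists>F\<subseteq>N. finite F \<and> Z F x = 0}"
  have U: "complex_subspace U"
    unfolding complex_subspace_def
  proof (intro conjI ballI allI)
    show "0 \<in> U" by (auto simp: U_def)
  next
    fix x y assume "x \<in> U" "y \<in> U"
    then obtain F G where F: "F \<subseteq> N" "finite F" "Z F x = 0" and G: "G \<subseteq> N" "finite G" "Z G y = 0"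
      by (auto simp: U_def)
    have "Z (F \<union> G) x = Z (F \<union> G) (Z F x)" "Z (F \<union> G) y = Z (F \<union> G) (Z G y)"
      by (rule ZZ[symmetric]; use F G in simp)+
    hence "Z (F \<union> G) x = 0" "Z (F \<union> G) y = 0" using F(3) G(3) by auto
    hence "Z (F \<union> G) (x + y) = 0" by (simp add: blinfun.add_right)
    thus "x + y \<in> U" unfolding U_def using F G by (intro CollectI exI[of _ "F \<union> G"]) simp
  next
    fix c x assume "x \<in> U"
    then obtain F where F: "F \<subseteq> N" "finite F" "Z F x = 0" by (auto simp: U_def)
    hence "Z F (c *\<^sub>C x) = 0" by (simp add: bounded_ops_scaleC[OF bounded_ops[OF ZM]])
    thus "c *\<^sub>C x \<in> U" using F by (auto simp: U_def)
  qed
  \<comment> \<open>Split \<open>y\<close> into \<open>p\<close> in the closure of \<open>U\<close>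
    and \<open>w\<close> orthogonal to it. The part \<open>w\<close> is \<open>P y\<close> and is
    fixed by every \<open>Z G\<close>, while \<open>p\<close> is approximated by vectors that
    \<open>Z G\<close> kills once \<open>G\<close> is large.\<close>
  have conv: "((\<lambda>F. Z F y) \<longlongrightarrow> P y) (finite_subsets_at_top N)" for y
  proof -
    obtain p where p: "p \<in> closure U" and orth: "\<And>s. s \<in> closure U \<Longrightarrow> cinner s (y - p) = 0"
      using orthogonal_decomposition[OF complex_subspace_closure[OF U] closed_closure] by metis
    define w where "w = y - p"
    \<comment> \<open>\<open>w - Z {B} w\<close> is killed by \<open>Z {B}\<close>, so it lies in
      \<open>U\<close> and is orthogonal to \<open>w\<close>; being also orthogonal to
      \<open>Z {B} w\<close>, it vanishes.\<close>
    have "B w = 0" if "B \<in> N" for B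
    proof -
      have B: "{B} \<subseteq> N" "finite {B}" using that by auto
      note ZB = projectionD[OF Zp[OF B(1)]]
      have "w - Z {B} w \<in> U"
        unfolding U_def using B ZB(2) by (auto simp: blinfun.diff_right intro!: exI[of _ "{B}"])
      hence 0: "cinner (w - Z {B} w) w = 0" using orth closure_subset w_def by blast
      have "cinner (w - Z {B} w) (w - Z {B} w) = 0"
        using 0 by (simp add: cinner_diff_left cinner_diff_right ZB)
      hence "Z {B} w = w" by (simp add: cinner_eq_zero_iff)
      thus ?thesis using Zfix[OF B] by simp
    qed
    hence w_range: "w \<in> range P" using P(2) by blast
    hence Pw: "P w = w" using projection_range_iff[OF P(1)] by blast
    have Pker: "B (P x) = 0" if "B \<in> N" for B x using P(2) that by blast
    have "P u = 0" if u: "u \<in> U" for u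
    proof -
      obtain F where F: "F \<subseteq> N" "finite F" "Z F u = 0" using u unfolding U_def by blast
      have "Z F (P u) = P u" unfolding Zfix[OF F(1,2)] using Pker F(1) by blast
      hence "cinner (P u) u = cinner (P u) (Z F u)" by (metis projectionD(4)[OF Zp[OF F(1)]])
      hence "cinner (P u) (P u) = 0" using F(3) projectionD[OF P(1)] by (metis cinner_zero_right)
      thus ?thesis by (simp add: cinner_eq_zero_iff)
    qed
    hence "U \<subseteq> {x. P x = 0}" by blast
    moreover have "closed {x. P x = 0}" by (intro closed_Collect_eq continuous_intros)
    ultimately have "closure U \<subseteq> {x. P x = 0}" by (rule closure_minimal)
    hence "P p = 0" using p by blast
    hence Py: "P y = w" using Pw by (simp add: w_def blinfun.diff_right)
    show ?thesis
    proof (rule tendstoI)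
      fix e :: real assume "e > 0"
      then obtain u where u: "u \<in> U" "dist u p < e"
        using p unfolding closure_approachable by blast
      obtain F where F: "F \<subseteq> N" "finite F" "Z F u = 0" using u(1) unfolding U_def by blast
      have "dist (Z G y) (P y) < e" if G: "finite G" "F \<subseteq> G" "G \<subseteq> N" for G
      proof -
        have "Z G u = Z G (Z F u)" using ZZ[OF G(2,3,1)] by simp
        hence 0: "Z G u = 0" using F(3) by simp
        have "Z G w = w" using Zfix[OF G(3,1)] Pker Pw G(3) by (metis subsetD)
        hence "Z G y - Z G p = w" by (simp add: w_def blinfun.diff_right)
        hence "Z G y - P y = Z G (p - u)" using Py 0 by (simp add: blinfun.diff_right algebra_simps)
        hence "norm (Z G y - P y) \<le> norm (p - u)" using norm_projection_le[OF Zp[OF G(3)]] by simp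
        thus ?thesis using u(2) by (simp add: dist_norm norm_minus_commute)
      qed
      thus "\<forall>\<^sub>F G in finite_subsets_at_top N. dist (Z G y) (P y) < e"
        unfolding eventually_finite_subsets_at_top using F by blast
    qed
  qed
  show ?thesis
  proof (rule strong_limit_in[OF _ _ conv])
    show "finite_subsets_at_top N \<noteq> bot" by simp
    show "\<forall>\<^sub>F F in finite_subsets_at_top N. Z F \<in> M"
      unfolding eventually_finite_subsets_at_top using ZM by blast
  qed
qed

section \<open>Polar decomposition and commutation with projections\<close>

text \<open>The displayed equation says exactly that \<open>I - S\<close> squares to
  \<open>A\<^sup>2\<close>. It is a fixed-point equation for \<open>S\<close>, solved by iterating
  from 0; every iterate is a polynomial in \<open>A\<close>, which gives symmetry and commutation
  with \<open>A\<close>.\<close>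

lemma square_root_complement:
  assumes A: "A \<in> M" and sa: "adj A = A" and nA: "norm A \<le> 1"
  obtains S where "S \<in> M" "adj S = S" "norm S \<le> 1" "A o\<^sub>L S = S o\<^sub>L A"
    "2 *\<^sub>R S = id_blinfun - (A o\<^sub>L A) + (S o\<^sub>L S)"
proof -
  define B where "B = id_blinfun - (A o\<^sub>L A)"
  define S where "S = rec_nat 0 (\<lambda>_ T. (1/2) *\<^sub>R (B + (T o\<^sub>L T)))"
  \<comment> \<open>The same iteration with \<open>B\<close> replaced by its norm bound 1. Its
    increments dominate those of \<open>S\<close> in norm, and they are summable because
    \<open>s\<close> increases and stays below 1.\<close>
  define s where "s = rec_nat (0::real) (\<lambda>_ t. (1 + t\<^sup>2) / 2)"
  have S0: "S 0 = 0" and S_Suc: "S (Suc n) = (1/2) *\<^sub>R (B + (S n o\<^sub>L S n))" for n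
    by (simp_all add: S_def)
  have s0: "s 0 = 0" and s_Suc: "s (Suc n) = (1 + (s n)\<^sup>2) / 2" for n
    by (simp_all add: s_def)
  note Ab = bounded_ops[OF A]
  have A_sym: "cinner (A x) y = cinner x (A y)" for x y
    using cinner_adj_left[OF Ab, of x y] sa by simp
  have A_le: "norm (A x) \<le> norm x" for x
    using norm_blinfun[of A x] nA mult_right_mono[OF nA, of "norm x"] by simp
  have BM: "B \<in> M" unfolding B_def by (intro diff_in id_in compose_in A)
  have B_le: "norm B \<le> 1"
  proof (rule norm_blinfun_bound)
    fix x
    have "Re (cinner x (A (A x))) = (norm (A x))\<^sup>2"
      by (simp add: norm_squared_eq_cinner A_sym)
    hence "(norm (B x))\<^sup>2 = (norm x)\<^sup>2 - 2 * (norm (A x))\<^sup>2 + (norm (A (A x)))\<^sup>2"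
      by (simp add: B_def blinfun.diff_left norm_diff_squared)
    moreover have "(norm (A (A x)))\<^sup>2 \<le> (norm (A x))\<^sup>2" by (intro power_mono A_le) simp
    ultimately have "(norm (B x))\<^sup>2 \<le> (norm x)\<^sup>2"
      using zero_le_power2[of "norm (A x)"] by linarith
    thus "norm (B x) \<le> 1 * norm x" by (simp add: power2_le_iff_abs_le)
  qed simp
  have SM: "S n \<in> M" for n
    by (induction n) (auto simp: S0 S_Suc zero_in intro!: scaleR_in add_in BM compose_in)
  have B_sym: "cinner (B x) y = cinner x (B y)" for x y
    by (simp add: B_def blinfun.diff_left cinner_simps A_sym)
  have S_sym: "cinner (S n x) y = cinner x (S n y)" for n x y
    by (induction n arbitrary: x y)
      (simp_all add: S0 S_Suc blinfun.scaleR_left blinfun.add_left cinner_simps B_sym)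
  have S_comm: "A o\<^sub>L S n = S n o\<^sub>L A" for n
  proof (induction n)
    case (Suc n)
    hence *: "A (S n x) = S n (A x)" for x by (metis blinfun_apply_blinfun_compose)
    show ?case
      by (rule blinfun_eqI)
        (simp add: S_Suc B_def blinfun.scaleR_left blinfun.scaleR_right blinfun.add_left
          blinfun.add_right blinfun.diff_left blinfun.diff_right *)
  qed (simp add: S0 blinfun_eqI)
  have s_bounds: "0 \<le> s n \<and> s n \<le> 1" for n
  proof (induction n)
    case (Suc n)
    hence "(s n)\<^sup>2 \<le> 1" by (simp add: power_le_one)
    thus ?case by (simp add: s_Suc)
  qed (simp add: s0)
  have S_le: "norm (S n) \<le> s n" for n
  proof (induction n)
    case (Suc n)
    have "norm (S n o\<^sub>L S n) \<le> s n * s n"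
      by (rule order_trans[OF norm_blinfun_compose]) (intro mult_mono Suc.IH, use s_bounds in auto)
    hence "norm (B + (S n o\<^sub>L S n)) \<le> 1 + s n * s n"
      using norm_triangle_ineq[of B "S n o\<^sub>L S n"] B_le by linarith
    thus ?case by (simp add: S_Suc s_Suc power2_eq_square)
  qed (simp add: S0 s0)
  have diff_le: "norm (S (Suc n) - S n) \<le> s (Suc n) - s n" for n
  proof (induction n)
    case 0
    show ?case using S_le[of 1] by (simp add: S0 s0)
  next
    case (Suc n)
    define D where "D = S (Suc n) - S n"
    have "S (Suc (Suc n)) - S (Suc n)
        = (1/2) *\<^sub>R ((S (Suc n) o\<^sub>L S (Suc n)) - (S n o\<^sub>L S n))"
      by (subst (1 2) S_Suc) (simp add: algebra_simps flip: scaleR_diff_right)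
    \<comment> \<open>The noncommutative difference of squares; its norm bound matches the
      factorization of the corresponding scalar difference.\<close>
    also have "(S (Suc n) o\<^sub>L S (Suc n)) - (S n o\<^sub>L S n) = (S (Suc n) o\<^sub>L D) + (D o\<^sub>L S n)"
      by (rule blinfun_eqI)
        (simp add: D_def blinfun.add_left blinfun.diff_left blinfun.diff_right)
    finally have eq: "S (Suc (Suc n)) - S (Suc n) = (1/2) *\<^sub>R ((S (Suc n) o\<^sub>L D) + (D o\<^sub>L S n))" .
    have "norm ((S (Suc n) o\<^sub>L D) + (D o\<^sub>L S n))
        \<le> norm (S (Suc n)) * norm D + norm D * norm (S n)"
      by (intro norm_triangle_le add_mono norm_blinfun_compose)
    also have "\<dots> \<le> s (Suc n) * (s (Suc n) - s n) + (s (Suc n) - s n) * s n"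
      using Suc s_bounds S_le order_trans[OF norm_ge_zero Suc]
      by (intro add_mono mult_mono) (auto simp: D_def)
    also have "\<dots> = (s (Suc n))\<^sup>2 - (s n)\<^sup>2" by (simp add: power2_eq_square algebra_simps)
    finally have "norm (S (Suc (Suc n)) - S (Suc n)) \<le> ((s (Suc n))\<^sup>2 - (s n)\<^sup>2) / 2"
      unfolding eq by simp
    also have "\<dots> = s (Suc (Suc n)) - s (Suc n)"
      by (simp add: s_Suc[of "Suc n"] s_Suc[of n] field_simps)
    finally show ?case .
  qed
  have "s n \<le> s (Suc n)" for n using order_trans[OF norm_ge_zero diff_le[of n]] by simp
  hence "incseq s" by (rule incseq_SucI)
  then obtain l where "s \<longlonglongrightarrow> l"
    using incseq_convergent[of s 1] s_bounds by blast
  hence "summable (\<lambda>n. s (Suc n) - s n)" by (rule telescope_summable)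
  hence "summable (\<lambda>n. S (Suc n) - S n)"
    by (rule summable_comparison_test'[of _ 0]) (rule diff_le)
  hence "convergent (\<lambda>n. \<Sum>k<n. S (Suc k) - S k)"
    by (simp add: summable_iff_convergent)
  hence "convergent S" by (simp add: sum_lessThan_telescope S0)
  then obtain L where L: "S \<longlonglongrightarrow> L" by (auto simp: convergent_def)
  show thesis
  proof (rule that[of L])
    show LM: "L \<in> M" by (rule norm_limit_in[OF SM L])
    show "norm L \<le> 1"
    proof (rule tendsto_upperbound[OF tendsto_norm[OF L]])
      show "\<forall>\<^sub>F n in sequentially. norm (S n) \<le> 1"
        by (intro always_eventually allI order_trans[OF S_le]) (use s_bounds in simp)
    qed simp
    have "cinner (L x) y = cinner x (L y)" for x y
    proof (rule LIMSEQ_unique)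
      show "(\<lambda>n. cinner (S n x) y) \<longlonglongrightarrow> cinner (L x) y"
        by (intro tendsto_cinner blinfun.tendsto L tendsto_const)
      show "(\<lambda>n. cinner (S n x) y) \<longlonglongrightarrow> cinner x (L y)"
        unfolding S_sym by (intro tendsto_cinner blinfun.tendsto L tendsto_const)
    qed
    thus "adj L = L" by (intro adj_eqI bounded_ops LM)
    note comp = bounded_bilinear.tendsto[OF bounded_bilinear_blinfun_compose]
    show "A o\<^sub>L L = L o\<^sub>L A"
    proof (rule LIMSEQ_unique)
      show "(\<lambda>n. A o\<^sub>L S n) \<longlonglongrightarrow> (A o\<^sub>L L)" by (intro comp tendsto_const L)
      show "(\<lambda>n. A o\<^sub>L S n) \<longlonglongrightarrow> (L o\<^sub>L A)" unfolding S_comm by (intro comp tendsto_const L)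
    qed
    have "(\<lambda>n. S (Suc n)) \<longlonglongrightarrow> (1/2) *\<^sub>R (B + (L o\<^sub>L L))"
      unfolding S_Suc by (intro tendsto_intros comp L)
    hence "L = (1/2) *\<^sub>R (B + (L o\<^sub>L L))" using LIMSEQ_Suc[OF L] LIMSEQ_unique by blast
    hence "2 *\<^sub>R L = 2 *\<^sub>R ((1/2) *\<^sub>R (B + (L o\<^sub>L L)))" by simp
    thus "2 *\<^sub>R L = id_blinfun - (A o\<^sub>L A) + (L o\<^sub>L L)" by (simp add: B_def)
  qed
qed

text \<open>Polar decomposition of a self-adjoint contraction: \<open>R = |A|\<close>, and \<open>2K - I\<close> is the sign of
  \<open>A\<close>.\<close>

lemma self_adjoint_polar_decomposition:
  assumes A: "A \<in> M" and sa: "adj A = A" and nA: "norm A \<le> 1"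
  obtains R K where "R \<in> M" "adj R = R" "norm (2 *\<^sub>R R - id_blinfun) \<le> 1"
    "K \<in> M" "projection K" "A = 2 *\<^sub>R (R o\<^sub>L K) - R"
proof -
  obtain S where S: "S \<in> M" "adj S = S" "norm S \<le> 1" "A o\<^sub>L S = S o\<^sub>L A"
    and eq: "2 *\<^sub>R S = id_blinfun - (A o\<^sub>L A) + (S o\<^sub>L S)"
    using square_root_complement[OF assms] .
  note Ab = bounded_ops[OF A] and Sb = bounded_ops[OF S(1)]
  have A_sym: "cinner (A x) y = cinner x (A y)" for x y
    using cinner_adj_left[OF Ab, of x y] sa by simp
  have S_sym: "cinner (S x) y = cinner x (S y)" for x y
    using cinner_adj_left[OF Sb, of x y] S(2) by simp
  have A_le: "norm (A x) \<le> norm x" for x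
    using norm_blinfun[of A x] nA mult_right_mono[OF nA, of "norm x"] by simp
  have S_le: "norm (S x) \<le> norm x" for x
    using norm_blinfun[of S x] S(3) mult_right_mono[OF S(3), of "norm x"] by simp
  have AS: "A (S x) = S (A x)" for x using S(4) by (metis blinfun_apply_blinfun_compose)
  have eq_apply: "2 *\<^sub>R S x = x - A (A x) + S (S x)" for x
    using arg_cong[OF eq, of "\<lambda>T. T x"]
    by (simp add: blinfun.scaleR_left blinfun.add_left blinfun.diff_left)
  \<comment> \<open>Positivity of \<open>S\<close> is read off from its equation:
    \<open>I - A\<^sup>2\<close> is positive because \<open>A\<close> is a contraction, and
    \<open>S\<^sup>2\<close> is positive because \<open>S\<close> is self-adjoint.\<close>
  have S_pos: "Re (cinner x (S x)) \<ge> 0" for x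
  proof -
    have "2 * Re (cinner x (S x)) = Re (cinner x (2 *\<^sub>R S x))" by (simp add: cinner_simps)
    also have "\<dots> = (norm x)\<^sup>2 - (norm (A x))\<^sup>2 + (norm (S x))\<^sup>2"
      unfolding eq_apply by (simp add: cinner_simps norm_squared_eq_cinner A_sym S_sym)
    also have "\<dots> \<ge> 0" using power_mono[OF A_le[of x], of 2] by simp
    finally show ?thesis by simp
  qed
  have S_le_id: "Re (cinner x (S x)) \<le> (norm x)\<^sup>2" for x
  proof -
    have "Re (cinner x (S x)) \<le> norm x * norm (S x)"
      using cauchy_schwarz complex_Re_le_cmod order_trans by blast
    also have "\<dots> \<le> norm x * norm x" by (intro mult_left_mono S_le) simp
    finally show ?thesis by (simp add: power2_eq_square)
  qed
  text \<open>\<open>S - S\<^sup>2 = S (I - S) S + (I - S) S (I - S)\<close> is positive.\<close>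
  have S_square: "(norm (S x))\<^sup>2 \<le> Re (cinner x (S x))" for x
    using S_le_id[of "S x"] S_pos[of "x - S x"]
    by (simp add: cinner_simps blinfun.diff_right norm_squared_eq_cinner S_sym)
  define R where "R = id_blinfun - S"
  define D where "D = R - A"
  \<comment> \<open>The kernel of \<open>R - A\<close> is the subspace where \<open>A\<close> acts
    as \<open>R\<close>.\<close>
  define K where "K = kernel_projection D"
  have RM: "R \<in> M" unfolding R_def by (intro diff_in id_in S)
  have DM: "D \<in> M" unfolding D_def by (intro diff_in RM A)
  have Ra: "adj R = R" by (simp add: R_def adj_diff id_in_bounded_ops Sb adj_id S(2))
  note K = projection_kernel_projection[OF bounded_ops[OF DM], folded K_def]
  have DK: "D (K x) = 0" for x
    unfolding K_def by (rule apply_kernel_projection[OF bounded_ops[OF DM]])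
  \<comment> \<open>\<open>R\<close> and \<open>A\<close> commute and have equal squares, so
    \<open>(R - A) (R + A) = 0\<close>.\<close>
  have "D (R x + A x) = 0" for x
  proof -
    have "R (R x) = A (A x)"
      using eq_apply[of x]
      by (simp add: R_def blinfun.diff_left blinfun.diff_right algebra_simps scaleR_2)
    moreover have "R (A x) = A (R x)"
      by (simp add: R_def blinfun.diff_left blinfun.diff_right AS)
    ultimately show ?thesis by (simp add: D_def blinfun.diff_left blinfun.add_right)
  qed
  hence K_fix: "K (R x + A x) = R x + A x" for x
    unfolding K_def kernel_projection_fixes_iff[OF bounded_ops[OF DM]] .
  have R_sym: "cinner (R x) y = cinner x (R y)" for x y
    using cinner_adj_left[OF bounded_ops[OF RM], of x y] Ra by simp
  \<comment> \<open>The adjoint of \<open>K_fix\<close>: together with \<open>R K = A K\<close> it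
    yields \<open>2 R K = R + A\<close>.\<close>
  have sum: "R (K x) + A (K x) = R x + A x" for x
  proof (rule cinner_eq_right_imp_eq)
    fix z
    have "cinner z (R (K x) + A (K x)) = cinner (K (R z + A z)) x"
      by (simp add: cinner_simps R_sym A_sym projectionD(4)[OF K])
    thus "cinner z (R (K x) + A (K x)) = cinner z (R x + A x)"
      by (simp add: K_fix cinner_simps R_sym A_sym)
  qed
  show thesis
  proof (rule that[OF RM Ra])
    show "K \<in> M" unfolding K_def by (rule kernel_projection_in[OF DM])
    show "projection K" by (rule K)
    \<comment> \<open>\<open>2 R - I = I - 2 S\<close>, and \<open>S\<^sup>2 \<le> S\<close> makes
      this a contraction; so it can take the place of \<open>A\<close> in a further
      decomposition.\<close>
    show "norm (2 *\<^sub>R R - id_blinfun) \<le> 1"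
    proof (rule norm_blinfun_bound)
      fix x
      have "(2 *\<^sub>R R - id_blinfun) x = x - 2 *\<^sub>R S x"
        by (simp add: R_def blinfun.diff_left blinfun.add_left blinfun.scaleR_left algebra_simps scaleR_2)
      moreover have "(norm (x - 2 *\<^sub>R S x))\<^sup>2 \<le> (norm x)\<^sup>2"
        unfolding norm_diff_squared using S_square[of x]
        by (simp add: cinner_simps power_mult_distrib)
      ultimately show "norm ((2 *\<^sub>R R - id_blinfun) x) \<le> 1 * norm x"
        by (simp add: power2_le_iff_abs_le)
    qed simp
    show "A = 2 *\<^sub>R (R o\<^sub>L K) - R"
    proof (rule blinfun_eqI)
      fix x
      have "R (K x) = A (K x)" using DK[of x] by (simp add: D_def blinfun.diff_left)
      hence "2 *\<^sub>R R (K x) = R x + A x" using sum[of x] by (simp add: scaleR_2)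
      thus "A x = (2 *\<^sub>R (R o\<^sub>L K) - R) x" by (simp add: blinfun.diff_left blinfun.scaleR_left)
    qed
  qed
qed

text \<open>By the polar decomposition \<open>A = |A| (2K - I)\<close>, commutators with \<open>A\<close> and with \<open>|A|\<close> have the
  same size on \<open>W\<close>; as \<open>2|A| - I\<close> is again a self-adjoint contraction, each step halves the bound.\<close>

lemma contraction_commutator_bound:
  assumes inv: "\<And>A w. A \<in> M \<Longrightarrow> w \<in> W \<Longrightarrow> blinfun_apply A w \<in> W"
    and diff: "\<And>v w. v \<in> W \<Longrightarrow> w \<in> W \<Longrightarrow> v - w \<in> W"
    and comm: "\<And>E X w. E \<in> M \<Longrightarrow> projection E \<Longrightarrow> X \<in> M \<Longrightarrow> w \<in> W \<Longrightarrow>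
      E (X w) = X (blinfun_apply E w)"
    and X: "X \<in> M" and A: "A \<in> M" "adj A = A" "norm A \<le> 1" and w: "w \<in> W"
  shows "norm (A (X w) - X (A w)) \<le> (1/2) ^ n * (2 * norm X * norm w)"
  using A w
proof (induction n arbitrary: A w)
  case 0
  have A_le: "norm (A x) \<le> norm x" for x
    using norm_blinfun[of A x] mult_right_mono[OF 0(3), of "norm x"] by simp
  have "norm (A (X w)) \<le> norm X * norm w" by (rule order_trans[OF A_le norm_blinfun])
  moreover have "norm (X (A w)) \<le> norm X * norm w"
    by (rule order_trans[OF norm_blinfun]) (intro mult_left_mono A_le norm_ge_zero)
  ultimately show ?case
    using norm_triangle_ineq4[of "A (X w)" "X (A w)"] by simp
next
  case (Suc n)
  obtain R K where R: "R \<in> M" "adj R = R" "norm (2 *\<^sub>R R - id_blinfun) \<le> 1"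
    and K: "K \<in> M" "projection K" and A: "A = 2 *\<^sub>R (R o\<^sub>L K) - R"
    using self_adjoint_polar_decomposition[OF Suc.prems(1-3)] .
  define T where "T = 2 *\<^sub>R R - id_blinfun"
  define v where "v = K w - (w - K w)"
  have TM: "T \<in> M" unfolding T_def by (intro diff_in scaleR_in id_in R)
  have "cinner (T x) y = cinner x (T y)" for x y
    using cinner_adj_left[OF bounded_ops[OF R(1)], of x y] R(2)
    by (simp add: T_def blinfun.diff_left blinfun.scaleR_left cinner_simps)
  hence Ta: "adj T = T" by (intro adj_eqI bounded_ops TM)
  have vW: "v \<in> W" unfolding v_def by (intro diff inv Suc.prems K)
  have "(norm v)\<^sup>2 = (norm w)\<^sup>2"
  proof -
    have "cinner (K w) (w - K w) = 0"
      by (simp add: projectionD[OF K(2)] blinfun.diff_right)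
    thus ?thesis
      using norm_add_squared[of "K w" "w - K w"] norm_diff_squared[of "K w" "w - K w"]
      by (simp add: v_def)
  qed
  hence vw: "norm v = norm w" by simp
  have "A (X w) - X (A w) = R (X v) - X (R v)"
    using comm[OF K X Suc.prems(4)]
    by (simp add: A v_def blinfun.diff_left blinfun.diff_right blinfun.add_left
        blinfun.add_right scaleR_2)
  also have "\<dots> = (1/2) *\<^sub>R (T (X v) - X (T v))"
    by (simp add: T_def blinfun.diff_left blinfun.diff_right blinfun.scaleR_left
        blinfun.scaleR_right flip: scaleR_diff_right)
  finally have "norm (A (X w) - X (A w)) = norm (T (X v) - X (T v)) / 2" by simp
  also have "\<dots> \<le> (1/2) ^ n * (2 * norm X * norm v) / 2"
    using Suc.IH[OF TM Ta R(3)[folded T_def] vW] by simp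
  finally show ?case by (simp add: vw)
qed

lemma commutes_if_projections_commute:
  assumes inv: "\<And>A w. A \<in> M \<Longrightarrow> w \<in> W \<Longrightarrow> blinfun_apply A w \<in> W"
    and diff: "\<And>v w. v \<in> W \<Longrightarrow> w \<in> W \<Longrightarrow> v - w \<in> W"
    and comm: "\<And>E X w. E \<in> M \<Longrightarrow> projection E \<Longrightarrow> X \<in> M \<Longrightarrow> w \<in> W \<Longrightarrow>
      E (X w) = X (blinfun_apply E w)"
    and A: "A \<in> M" and X: "X \<in> M" and w: "w \<in> W"
  shows "A (X w) = X (A w)"
proof -
  have contraction: "A (X w) = X (A w)" if A: "A \<in> M" "adj A = A" "norm A \<le> 1" for A
  proof -
    have "(\<lambda>n. (1/2) ^ n * (2 * norm X * norm w)) \<longlonglongrightarrow> 0 * (2 * norm X * norm w)"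
      by (intro tendsto_mult tendsto_const LIMSEQ_power_zero) simp
    hence "norm (A (X w) - X (A w)) \<le> 0"
      using contraction_commutator_bound[OF inv diff comm X A w]
      by (intro tendsto_lowerbound[of _ 0 sequentially]) auto
    thus ?thesis by simp
  qed
  have self_adjoint: "A (X w) = X (A w)" if A: "A \<in> M" "adj A = A" for A
  proof -
    define r where "r = inverse (norm A + 1)"
    have pos: "0 < norm A + 1" by (simp add: add_nonneg_pos)
    hence r: "r > 0" by (simp add: r_def)
    have "r * norm A \<le> 1" using pos by (simp add: r_def divide_simps)
    hence "norm (r *\<^sub>R A) \<le> 1" using r by simp
    moreover have "adj (r *\<^sub>R A) = r *\<^sub>R A"
      using cinner_adj_left[OF bounded_ops[OF A(1)]] A(2)
      by (intro adj_eqI bounded_ops scaleR_in A) (simp add: blinfun.scaleR_left cinner_simps)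
    ultimately have "(r *\<^sub>R A) (X w) = X ((r *\<^sub>R A) w)"
      using A by (intro contraction scaleR_in)
    thus ?thesis using r by (simp add: blinfun.scaleR_left blinfun.scaleR_right)
  qed
  note Ab = bounded_ops[OF A]
  define P where "P = A + adj A"
  define Q where "Q = op_scaleC \<i> (A - adj A)"
  have PM: "P \<in> M" and QM: "Q \<in> M"
    unfolding P_def Q_def by (intro add_in scaleC_in diff_in adj_in A)+
  have "adj P = P"
    by (intro adj_eqI bounded_ops PM)
      (simp add: P_def blinfun.add_left cinner_simps cinner_adj_left[OF Ab] cinner_adj_right[OF Ab])
  hence P: "P (X w) = X (P w)" by (rule self_adjoint[OF PM])
  have "adj Q = Q"
    by (intro adj_eqI bounded_ops QM)
      (simp add: Q_def op_scaleC.rep_eq blinfun.diff_left cinner_simps cinner_adj_left[OF Ab]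
        cinner_adj_right[OF Ab] algebra_simps)
  hence Q: "Q (X w) = X (Q w)" by (rule self_adjoint[OF QM])
  have dec: "2 *\<^sub>R A x = P x - \<i> *\<^sub>C Q x" for x
  proof -
    have "\<i> *\<^sub>C Q x = (-1) *\<^sub>R (A x - adj A x)"
      by (simp add: Q_def op_scaleC.rep_eq scaleC_scaleC scaleR_scaleC blinfun.diff_left)
    thus ?thesis by (simp add: P_def blinfun.add_left scaleR_2)
  qed
  have "2 *\<^sub>R A (X w) = X (2 *\<^sub>R A w)"
    unfolding dec using P Q
    by (simp add: blinfun.diff_right bounded_ops_scaleC[OF bounded_ops[OF X]])
  thus ?thesis by (simp add: blinfun.scaleR_right)
qed

end

section \<open>Orthogonally additive range-contractive maps\<close>

locale normalized_map = von_neumann M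
  for M :: "('h::complex_hilbert_space \<Rightarrow>\<^sub>L 'h) set" +
  fixes \<Psi> :: "('h \<Rightarrow>\<^sub>L 'h) \<Rightarrow> ('h \<Rightarrow>\<^sub>L 'h)"
  assumes maps: "A \<in> M \<Longrightarrow> \<Psi> A \<in> M"
    and additive: "A \<in> M \<Longrightarrow> B \<in> M \<Longrightarrow> adj A o\<^sub>L B = 0 \<Longrightarrow> \<Psi> (A + B) = \<Psi> A + \<Psi> B"
    and range_subset: "A \<in> M \<Longrightarrow> range (\<Psi> A) \<subseteq> closure (range A)"
    and map_id: "\<Psi> id_blinfun = 0"
begin

lemma map_zero: "\<Psi> 0 = 0"
proof -
  have "\<Psi> (0 + 0) = \<Psi> 0 + \<Psi> 0" by (rule additive) (simp_all add: zero_in)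
  thus ?thesis by simp
qed

lemma range_in_projection:
  assumes "projection P" "A \<in> M" "\<And>x. P (A x) = A x"
  shows "P (\<Psi> A x) = \<Psi> A x"
proof -
  have "range A \<subseteq> range P" using assms(3) by (metis image_subset_iff rangeI)
  hence "closure (range A) \<subseteq> range P"
    by (rule closure_minimal) (rule closed_range_projection[OF assms(1)])
  hence "\<Psi> A x \<in> range P" using range_subset[OF assms(2)] by blast
  thus ?thesis using projection_range_iff[OF assms(1)] by blast
qed

lemma map_projection:
  assumes P: "P \<in> M" "projection P" and A: "A \<in> M"
  shows "\<Psi> (P o\<^sub>L A) = P o\<^sub>L \<Psi> A"
proof -
  define Q where "Q = id_blinfun - P"
  have Q: "Q \<in> M" "projection Q"
    unfolding Q_def by (intro diff_in id_in P projection_complement)+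
  have PA: "P o\<^sub>L A \<in> M" and QA: "Q o\<^sub>L A \<in> M" by (intro compose_in P Q A)+
  have PQ: "P (Q x) = 0" for x
    by (simp add: Q_def blinfun.diff_left blinfun.diff_right projectionD(2)[OF P(2)])
  have "adj (P o\<^sub>L A) o\<^sub>L (Q o\<^sub>L A) = 0"
    by (rule blinfun_eqI)
      (simp add: adj_compose[OF bounded_ops[OF P(1)] bounded_ops[OF A]] projectionD(3)[OF P(2)] PQ)
  moreover have "(P o\<^sub>L A) + (Q o\<^sub>L A) = A"
    by (rule blinfun_eqI) (simp add: Q_def blinfun.add_left blinfun.diff_left)
  ultimately have sum: "\<Psi> A = \<Psi> (P o\<^sub>L A) + \<Psi> (Q o\<^sub>L A)"
    using additive[OF PA QA] by simp
  show ?thesis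
  proof (rule blinfun_eqI)
    fix x
    have "P (\<Psi> (P o\<^sub>L A) x) = \<Psi> (P o\<^sub>L A) x"
      by (rule range_in_projection[OF P(2) PA]) (simp add: projectionD(2)[OF P(2)])
    moreover have "Q (\<Psi> (Q o\<^sub>L A) x) = \<Psi> (Q o\<^sub>L A) x"
      by (rule range_in_projection[OF Q(2) QA]) (simp add: projectionD(2)[OF Q(2)])
    hence "P (\<Psi> (Q o\<^sub>L A) x) = 0" by (metis PQ)
    ultimately show "\<Psi> (P o\<^sub>L A) x = (P o\<^sub>L \<Psi> A) x"
      by (simp add: sum blinfun.add_left blinfun.add_right)
  qed
qed

text \<open>With \<open>G\<close> the projection onto \<open>{x + K\<^sup>*x | x \<in> ran E}\<close> one has \<open>G Y = G K Y\<close>, so applying \<open>G\<close>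
  to \<open>\<Psi> (X + Y) = \<Psi> X + \<Psi> Y\<close> turns orthogonal additivity into additivity on operators of the
  same range; \<open>G\<close> is injective on the range of \<open>E\<close>.\<close>

lemma map_add_off_diagonal:
  assumes E: "E \<in> M" "projection E"
    and K: "K \<in> M" "E o\<^sub>L K = K" "K o\<^sub>L E = 0"
    and X: "X \<in> M" "E o\<^sub>L X = X" and Y: "Y \<in> M" "E o\<^sub>L Y = 0"
  shows "\<Psi> (X + (K o\<^sub>L Y)) = \<Psi> X + (K o\<^sub>L \<Psi> Y)"
proof -
  have EK: "E (K x) = K x" and KE: "K (E x) = 0" and EX: "E (X x) = X x" and EY: "E (Y x) = 0"
    for x
    using K X Y by (metis blinfun_apply_blinfun_compose zero_blinfun.rep_eq)+
  define B where "B = E + K"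
  define G where "G = id_blinfun - kernel_projection B"
  have BM: "B \<in> M" unfolding B_def by (intro add_in E K)
  note ker = kernel_projection_fixes_iff[OF bounded_ops[OF BM]]
  have G: "G \<in> M" "projection G"
    unfolding G_def by (intro diff_in id_in kernel_projection_in BM projection_complement
        projection_kernel_projection bounded_ops)+
  have G0: "G x = 0 \<longleftrightarrow> B x = 0" for x
    using ker[of x] by (auto simp: G_def blinfun.diff_left)
  have KK: "K (K x) = 0" for x using KE[of "K x"] EK[of x] by simp
  have GY: "G v = G (K v)" if "E v = 0" for v
  proof -
    have "B (v - K v) = 0"
      using that by (simp add: B_def blinfun.add_left blinfun.diff_right EK KK)
    thus ?thesis using G0[of "v - K v"] by (simp add: blinfun.diff_right)
  qed
  have G_inj: "x = 0" if "G x = 0" "E x = x" for x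
  proof -
    have "B x = 0" using that(1) G0 by simp
    moreover have "K x = 0" using KE[of x] that(2) by simp
    ultimately show ?thesis using that(2) by (simp add: B_def blinfun.add_left)
  qed
  have KY: "K o\<^sub>L Y \<in> M" and XKY: "X + (K o\<^sub>L Y) \<in> M" and XY: "X + Y \<in> M"
    by (intro add_in compose_in X K Y)+
  have "adj X o\<^sub>L Y = 0"
  proof (rule blinfun_eqI, rule cinner_eq_right_imp_eq)
    fix x z
    have "cinner z (adj X (Y x)) = cinner (E (X z)) (Y x)"
      by (simp add: cinner_adj_right[OF bounded_ops[OF X(1)]] EX)
    also have "\<dots> = 0" by (simp add: projectionD(4)[OF E(2)] EY)
    finally show "cinner z ((adj X o\<^sub>L Y) x) = cinner z (blinfun_apply 0 x)" by simp
  qed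
  hence sum: "\<Psi> (X + Y) = \<Psi> X + \<Psi> Y" by (rule additive[OF X(1) Y(1)])
  have "G o\<^sub>L (X + Y) = G o\<^sub>L (X + (K o\<^sub>L Y))"
    by (rule blinfun_eqI) (simp add: blinfun.add_left blinfun.add_right GY[OF EY])
  hence "G o\<^sub>L \<Psi> (X + Y) = G o\<^sub>L \<Psi> (X + (K o\<^sub>L Y))"
    using map_projection[OF G XY] map_projection[OF G XKY] by simp
  hence eq: "G (\<Psi> X x) + G (\<Psi> Y x) = G (\<Psi> (X + (K o\<^sub>L Y)) x)" for x
    unfolding sum by (metis blinfun.add_left blinfun.add_right blinfun_apply_blinfun_compose)
  have EPX: "E (\<Psi> X x) = \<Psi> X x" for x by (rule range_in_projection[OF E(2) X(1) EX])
  have EPXKY: "E (\<Psi> (X + (K o\<^sub>L Y)) x) = \<Psi> (X + (K o\<^sub>L Y)) x" for x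
    by (rule range_in_projection[OF E(2) XKY])
      (simp add: blinfun.add_left blinfun.add_right EX EK)
  have EPY: "E (\<Psi> Y x) = 0" for x
  proof -
    have "\<Psi> (E o\<^sub>L Y) = E o\<^sub>L \<Psi> Y" by (rule map_projection[OF E Y(1)])
    hence "E o\<^sub>L \<Psi> Y = 0" by (simp add: Y(2) map_zero)
    thus ?thesis by (metis blinfun_apply_blinfun_compose zero_blinfun.rep_eq)
  qed
  show ?thesis
  proof (rule blinfun_eqI)
    fix x
    define d where "d = \<Psi> X x + K (\<Psi> Y x) - \<Psi> (X + (K o\<^sub>L Y)) x"
    have "G d = 0"
      using eq[of x] GY[OF EPY[of x]] by (simp add: d_def blinfun.diff_right blinfun.add_right)
    moreover have "E d = d"
      by (simp add: d_def blinfun.diff_right blinfun.add_right EPX EK EPXKY)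
    ultimately have "d = 0" by (rule G_inj)
    thus "\<Psi> (X + (K o\<^sub>L Y)) x = (\<Psi> X + (K o\<^sub>L \<Psi> Y)) x"
      by (simp add: d_def blinfun.add_left)
  qed
qed

lemma map_off_diagonal:
  assumes E: "E \<in> M" "projection E" and K: "K \<in> M" "E o\<^sub>L K = K" "K o\<^sub>L E = 0"
  shows "\<Psi> K = 0"
proof -
  define Q where "Q = id_blinfun - E"
  have Q: "Q \<in> M" "projection Q"
    unfolding Q_def by (intro diff_in id_in E projection_complement)+
  have "\<Psi> (Q o\<^sub>L id_blinfun) = Q o\<^sub>L \<Psi> id_blinfun" by (rule map_projection[OF Q id_in])
  moreover have "Q o\<^sub>L id_blinfun = Q" by (rule blinfun_eqI) simp
  ultimately have PQ: "\<Psi> Q = 0" by (simp add: map_id)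
  have "E o\<^sub>L Q = 0"
    by (rule blinfun_eqI)
      (simp add: Q_def blinfun.diff_left blinfun.diff_right projectionD(2)[OF E(2)])
  hence "\<Psi> (0 + (K o\<^sub>L Q)) = \<Psi> 0 + (K o\<^sub>L \<Psi> Q)"
    by (intro map_add_off_diagonal[OF E K] zero_in Q) simp
  moreover have "K o\<^sub>L Q = K"
  proof (rule blinfun_eqI)
    have "K (E x) = 0" for x using K(3) by (metis blinfun_apply_blinfun_compose zero_blinfun.rep_eq)
    thus "(K o\<^sub>L Q) x = K x" for x by (simp add: Q_def blinfun.diff_left blinfun.diff_right)
  qed
  ultimately show ?thesis by (simp add: PQ map_zero)
qed

lemma off_diagonal_annihilates:
  assumes E: "E \<in> M" "projection E" and L: "L \<in> M" "E o\<^sub>L L = 0" "L o\<^sub>L E = L" and A: "A \<in> M"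
  shows "L o\<^sub>L \<Psi> A = 0"
proof -
  define Q where "Q = id_blinfun - E"
  have Q: "Q \<in> M" "projection Q"
    unfolding Q_def by (intro diff_in id_in E projection_complement)+
  have Q_apply: "Q x = x - E x" for x by (simp add: Q_def blinfun.diff_left)
  have EL: "E (L x) = 0" and LE: "L (E x) = L x" for x
    using L by (metis blinfun_apply_blinfun_compose zero_blinfun.rep_eq)+
  note EE = projectionD(2)[OF E(2)]
  have QL: "Q o\<^sub>L L = L" "L o\<^sub>L Q = 0"
    by (rule blinfun_eqI, simp add: Q_apply EL LE blinfun.diff_right)+
  define X where "X = L o\<^sub>L A o\<^sub>L E"
  define Y where "Y = E o\<^sub>L A o\<^sub>L Q"
  have XM: "X \<in> M" and YM: "Y \<in> M" unfolding X_def Y_def by (intro compose_in L A E Q)+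
  have "\<Psi> X = 0"
    by (rule map_off_diagonal[OF Q XM]; rule blinfun_eqI)
      (simp_all add: X_def Q_apply EL EE blinfun.diff_right)
  moreover have "\<Psi> Y = 0"
    by (rule map_off_diagonal[OF E YM]; rule blinfun_eqI)
      (simp_all add: Y_def Q_apply EE blinfun.diff_right)
  moreover have "\<Psi> (X + (L o\<^sub>L Y)) = \<Psi> X + (L o\<^sub>L \<Psi> Y)"
    by (rule map_add_off_diagonal[OF Q L(1) QL XM _ YM]; rule blinfun_eqI)
      (simp_all add: X_def Y_def Q_apply EL EE blinfun.diff_right)
  moreover have "X + (L o\<^sub>L Y) = L o\<^sub>L A"
    by (rule blinfun_eqI)
      (simp add: X_def Y_def Q_apply LE blinfun.diff_right blinfun.add_left)
  ultimately have LA: "\<Psi> (L o\<^sub>L A) = 0" by simp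
  have EA: "E o\<^sub>L A \<in> M" by (intro compose_in E A)
  have "\<Psi> (0 + (L o\<^sub>L (E o\<^sub>L A))) = \<Psi> 0 + (L o\<^sub>L \<Psi> (E o\<^sub>L A))"
    by (rule map_add_off_diagonal[OF Q L(1) QL zero_in _ EA]; rule blinfun_eqI)
      (simp_all add: Q_apply EE)
  moreover have "L o\<^sub>L (E o\<^sub>L A) = L o\<^sub>L A" by (rule blinfun_eqI) (simp add: LE)
  moreover have "L o\<^sub>L \<Psi> (E o\<^sub>L A) = L o\<^sub>L \<Psi> A"
    by (rule blinfun_eqI) (simp add: map_projection[OF E A] LE)
  ultimately show ?thesis using LA by (simp add: map_zero)
qed

lemma projection_commutes_on_values:
  assumes E: "E \<in> M" "projection E" and X: "X \<in> M" and A: "A \<in> M"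
  shows "E (X (\<Psi> A x)) = X (E (\<Psi> A x))"
proof -
  define Q where "Q = id_blinfun - E"
  have Q: "Q \<in> M" "projection Q"
    unfolding Q_def by (intro diff_in id_in E projection_complement)+
  have Q_apply: "Q x = x - E x" for x by (simp add: Q_def blinfun.diff_left)
  note EE = projectionD(2)[OF E(2)]
  have "(Q o\<^sub>L X o\<^sub>L E) o\<^sub>L \<Psi> A = 0"
    by (rule off_diagonal_annihilates[OF E compose_in[OF compose_in[OF Q(1) X] E(1)] _ _ A];
        rule blinfun_eqI) (simp_all add: Q_apply EE blinfun.diff_right)
  from arg_cong[OF this, of "\<lambda>T. T x"]
  have 1: "X (E (\<Psi> A x)) = E (X (E (\<Psi> A x)))" by (simp add: Q_apply)
  have "(E o\<^sub>L X o\<^sub>L Q) o\<^sub>L \<Psi> A = 0"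
    by (rule off_diagonal_annihilates[OF Q compose_in[OF compose_in[OF E(1) X] Q(1)] _ _ A];
        rule blinfun_eqI) (simp_all add: Q_apply EE blinfun.diff_right)
  from arg_cong[OF this, of "\<lambda>T. T x"]
  have 2: "E (X (\<Psi> A x)) = E (X (E (\<Psi> A x)))" by (simp add: Q_apply blinfun.diff_right)
  show ?thesis using 1 2 by simp
qed

lemma map_eq_zero:
  assumes no_I1: "no_type_I1_summand M" and A: "A \<in> M"
  shows "\<Psi> A = 0"
proof -
  define N where "N = {((E o\<^sub>L X) - (X o\<^sub>L E)) o\<^sub>L L | E X L.
      E \<in> M \<and> projection E \<and> X \<in> M \<and> L \<in> M}"
  define W where "W = {w. \<forall>B\<in>N. blinfun_apply B w = 0}"
  have NM: "N \<subseteq> M" unfolding N_def by (auto intro!: compose_in diff_in)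
  have W_iff: "w \<in> W \<longleftrightarrow>
      (\<forall>E X L. E \<in> M \<and> projection E \<and> X \<in> M \<and> L \<in> M \<longrightarrow>
        E (X (L w)) = X (E (blinfun_apply L w)))" for w
  proof -
    have "w \<in> W \<longleftrightarrow> (\<forall>E X L. E \<in> M \<and> projection E \<and> X \<in> M \<and> L \<in> M \<longrightarrow>
        blinfun_apply (((E o\<^sub>L X) - (X o\<^sub>L E)) o\<^sub>L L) w = 0)"
      unfolding W_def N_def by blast
    thus ?thesis by (simp add: blinfun.diff_left)
  qed
  have W: "complex_subspace W"
    using NM bounded_ops_scaleC[OF bounded_ops]
    by (auto simp: complex_subspace_def W_def blinfun.add_right subset_iff)
  have "closed W"
  proof -
    have "W = (\<Inter>B\<in>N. {w. blinfun_apply B w = 0})" by (auto simp: W_def)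
    thus ?thesis by (auto intro!: closed_INT closed_Collect_eq continuous_intros)
  qed
  then obtain Z where Z: "projection Z" "range Z = W" using projection_onto_exists[OF W] by blast
  have ZM: "Z \<in> M" using projection_onto_common_kernel_in[OF NM Z(1)] Z(2) W_def by blast
  have inv: "B w \<in> W" if "B \<in> M" "w \<in> W" for B w
    unfolding W_iff
  proof (intro allI impI; elim conjE)
    fix E X L assume *: "E \<in> M" "projection E" "X \<in> M" "L \<in> M"
    have "L o\<^sub>L B \<in> M" by (intro compose_in * that)
    hence "E (X ((L o\<^sub>L B) w)) = X (E ((L o\<^sub>L B) w))" using that(2) * W_iff by blast
    thus "E (X (L (B w))) = X (E (L (B w)))" by simp
  qed
  have "central M Z"
    unfolding central_def
  proof (intro conjI ballI ZM)
    fix B assume "B \<in> M"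
    thus "B o\<^sub>L Z = Z o\<^sub>L B"
      by (intro projection_commutes_if_invariant[OF Z(1)]) (auto simp: Z(2) inv adj_in bounded_ops)
  qed
  moreover have comm: "B (C w) = C (B w)" if "B \<in> M" "C \<in> M" "w \<in> W" for B C w
  proof (rule commutes_if_projections_commute[OF inv complex_subspace_diff[OF W] _ that])
    fix E X w assume "E \<in> M" "projection E" "X \<in> M" "w \<in> W"
    hence "E (X (id_blinfun w)) = X (E (id_blinfun w))" using W_iff id_in by blast
    thus "E (X w) = X (blinfun_apply E w)" by simp
  qed
  have "abelian ((\<lambda>A. A o\<^sub>L Z) ` M)"
    unfolding abelian_def
  proof (intro ballI; elim imageE; clarify)
    fix B C assume BC: "B \<in> M" "C \<in> M"
    show "(B o\<^sub>L Z) o\<^sub>L (C o\<^sub>L Z) = (C o\<^sub>L Z) o\<^sub>L (B o\<^sub>L Z)"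
    proof (rule blinfun_eqI)
      fix x
      have Zx: "Z x \<in> W" using Z(2) by blast
      have "Z (B (Z x)) = B (Z x)" "Z (C (Z x)) = C (Z x)"
        using inv[OF _ Zx] BC projection_range_iff[OF Z(1)] Z(2) by auto
      thus "((B o\<^sub>L Z) o\<^sub>L (C o\<^sub>L Z)) x = ((C o\<^sub>L Z) o\<^sub>L (B o\<^sub>L Z)) x"
        using comm[OF BC Zx] by simp
    qed
  qed
  ultimately have "Z = 0" using no_I1 Z(1) unfolding no_type_I1_summand_def by blast
  show ?thesis
  proof (rule blinfun_eqI)
    fix x
    have "\<Psi> A x \<in> W"
      unfolding W_iff
    proof (intro allI impI; elim conjE)
      fix E X L assume *: "E \<in> M" "projection E" "X \<in> M" "L \<in> M"
      have "E ((X o\<^sub>L L) (\<Psi> A x)) = (X o\<^sub>L L) (E (\<Psi> A x))"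
        by (rule projection_commutes_on_values[OF *(1,2) compose_in[OF *(3,4)] A])
      moreover have "E (L (\<Psi> A x)) = L (E (\<Psi> A x))"
        by (rule projection_commutes_on_values[OF *(1,2,4) A])
      ultimately show "E (X (L (\<Psi> A x))) = X (E (L (\<Psi> A x)))" by simp
    qed
    hence "Z (\<Psi> A x) = \<Psi> A x" using projection_range_iff[OF Z(1)] Z(2) by blast
    thus "\<Psi> A x = blinfun_apply 0 x" using \<open>Z = 0\<close> by simp
  qed
qed

end

theorem theorem1p1:
  fixes M :: "('h::complex_hilbert_space \<Rightarrow>\<^sub>L 'h) set"
    and \<Phi> :: "('h \<Rightarrow>\<^sub>L 'h) \<Rightarrow> ('h \<Rightarrow>\<^sub>L 'h)"
  assumes "von_neumann_algebra M"
    and "no_type_I1_summand M"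
    and "\<Phi> \<in> M \<rightarrow> M"
    and "ortho_additive M \<Phi>"
    and "range_contractive M \<Phi>"
  shows "\<forall>A\<in>M. \<Phi> A = A o\<^sub>L \<Phi> id_blinfun"
proof -
  interpret von_neumann M by standard (rule assms(1))
  have maps: "\<Phi> A \<in> M" if "A \<in> M" for A using assms(3) that by blast
  define \<Psi> where "\<Psi> A = \<Phi> A - (A o\<^sub>L \<Phi> id_blinfun)" for A
  interpret normalized_map M \<Psi>
  proof
    show "\<Psi> A \<in> M" if "A \<in> M" for A
      unfolding \<Psi>_def by (intro diff_in compose_in maps that id_in)
    show "\<Psi> id_blinfun = 0" by (rule blinfun_eqI) (simp add: \<Psi>_def blinfun.diff_left)
    fix A assume A: "A \<in> M"
    show "\<Psi> (A + B) = \<Psi> A + \<Psi> B" if "B \<in> M" "adj A o\<^sub>L B = 0" for B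
    proof -
      have "\<Phi> (A + B) = \<Phi> A + \<Phi> B"
        using assms(4) A that unfolding ortho_additive_def orthogonal_ops_def by blast
      thus ?thesis
        by (intro blinfun_eqI) (simp add: \<Psi>_def blinfun.diff_left blinfun.add_left)
    qed
    show "range (\<Psi> A) \<subseteq> closure (range A)"
    proof (rule image_subsetI)
      fix x
      note Ab = bounded_ops[OF A] and PAb = bounded_ops[OF maps[OF A]]
      have "range (range_projection (\<Phi> A)) \<subseteq> range (range_projection A)"
        using assms(5) A unfolding range_contractive_def
        by (intro op_le_projection_imp_range_subset projection_range_projection Ab PAb) blast
      hence "closure (range (\<Phi> A)) \<subseteq> closure (range A)"
        by (simp add: range_range_projection[OF Ab] range_range_projection[OF PAb])
      moreover have "\<Phi> A x \<in> closure (range (\<Phi> A))" by (rule subsetD[OF closure_subset]) simp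
      ultimately have "\<Phi> A x \<in> closure (range A)" by blast
      moreover have "A (\<Phi> id_blinfun x) \<in> closure (range A)"
        by (rule subsetD[OF closure_subset]) simp
      ultimately have "\<Phi> A x - A (\<Phi> id_blinfun x) \<in> closure (range A)"
        by (rule complex_subspace_diff[OF complex_subspace_closure[OF complex_subspace_range[OF Ab]]])
      thus "\<Psi> A x \<in> closure (range A)" by (simp add: \<Psi>_def blinfun.diff_left)
    qed
  qed
  show ?thesis using map_eq_zero[OF assms(2)] by (simp add: \<Psi>_def)
qed

end
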